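(* Let $R$ be a ring and let $M$ be an $AB5^*$ right $R$-module which has Noetherian dimension. Let $\alpha$ be an ordinal and let $\{N_i\}_{i\in\Delta}$ be a family of submodules of $M$ such that $n\text{-}\dim (M/N_i)\le\alpha$ for each $i\in\Delta$. Then $n\text{-}\dim\bigl(M/\bigcap_{i\in\Delta}N_i\bigr)\le\alpha$.
   Context: Rings are associative with identity and modules are unital right modules. Ordinals are taken to begin with $-1$ (so $0$ is the successor of $-1$). Noetherian dimension (also called dual Krull dimension) $n\text{-}\dim M$: defined by transfinite recursion. $n\text{-}\dim M=-1$ iff $M=0$. For an ordinal $\alpha\ge 0$, $n\text{-}\dim M=\alpha$ iff $n\text{-}\dim M\not<\alpha$ and for every ascending chain $M_0\subseteq M_1\subseteq M_2\subseteq\cdots$ of submodules of $M$ there is $k$ with $n\text{-}\dim(M_{i+1}/M_i)<\alpha$ for all $i\ge k$. If no such ordinal exists, $M$ does not have Noetherian dimension. Thus a nonzero module has Noetherian dimension $0$ iff it is Noetherian. A statement such as $n\text{-}\dim X\le\alpha$ includes the assertion that $X$ has Noetherian dimension. A module $M$ is an $AB5^*$ module if for every submodule $B$ of $M$ and every inverse system (i.e. downward directed family) $\{A_i\}_{i\in I}$ of submodules of $M$, $B+\bigcap_{i\in I}A_i=\bigcap_{i\in I}(B+A_i)$. *)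

theory Defs
  imports "HOL-Algebra.Module" "HOL-Algebra.AbelCoset"
begin

text \<open>
  The library's modules are over commutative rings only.  Right modules over an arbitrary
  unital ring reuse its record type: \<open>a \<odot> x\<close> stands for the right action \<open>x a\<close>,
  so that the associativity law reads \<open>(x a) b = x (a b)\<close>.  The library's locale
  \<open>submodule\<close> and the record update \<open>M\<lparr>carrier := H\<rparr>\<close> do not depend on commutativity.
\<close>

locale right_module = R?: ring R + M?: abelian_group M
  for R :: "('a, 'm) ring_scheme" (structure) and M :: "('a, 'b) module" (structure) +
  assumes smult_closed [simp, intro]:
      "\<lbrakk>a \<in> carrier R; x \<in> carrier M\<rbrakk> \<Longrightarrow> a \<odot>\<^bsub>M\<^esub> x \<in> carrier M"
    and smult_l_distr:
      "\<lbrakk>a \<in> carrier R; b \<in> carrier R; x \<in> carrier M\<rbrakk> \<Longrightarrow>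
        (a \<oplus>\<^bsub>R\<^esub> b) \<odot>\<^bsub>M\<^esub> x = a \<odot>\<^bsub>M\<^esub> x \<oplus>\<^bsub>M\<^esub> b \<odot>\<^bsub>M\<^esub> x"
    and smult_r_distr:
      "\<lbrakk>a \<in> carrier R; x \<in> carrier M; y \<in> carrier M\<rbrakk> \<Longrightarrow>
        a \<odot>\<^bsub>M\<^esub> (x \<oplus>\<^bsub>M\<^esub> y) = a \<odot>\<^bsub>M\<^esub> x \<oplus>\<^bsub>M\<^esub> a \<odot>\<^bsub>M\<^esub> y"
    and smult_assoc:
      "\<lbrakk>a \<in> carrier R; b \<in> carrier R; x \<in> carrier M\<rbrakk> \<Longrightarrow>
        b \<odot>\<^bsub>M\<^esub> (a \<odot>\<^bsub>M\<^esub> x) = (a \<otimes>\<^bsub>R\<^esub> b) \<odot>\<^bsub>M\<^esub> x"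
    and smult_one [simp]:
      "x \<in> carrier M \<Longrightarrow> \<one>\<^bsub>R\<^esub> \<odot>\<^bsub>M\<^esub> x = x"

text \<open>
  The multiplicative fields of a module record carry no meaning.
\<close>

definition quotient_module :: "('a, 'b) module \<Rightarrow> 'b set \<Rightarrow> ('a, 'b set) module"
  where "quotient_module M N =
    \<lparr>carrier = a_rcosets\<^bsub>M\<^esub> N, mult = undefined, one = undefined,
     zero = N, add = set_add M,
     smult = (\<lambda>a X. \<Union>x\<in>X. N +>\<^bsub>M\<^esub> (a \<odot>\<^bsub>M\<^esub> x))\<rparr>"

definition right_module_iso ::
    "('a, 'm) ring_scheme \<Rightarrow> ('a, 'b) module \<Rightarrow> ('a, 'c) module \<Rightarrow> ('b \<Rightarrow> 'c) set"
  where "right_module_iso R M N =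
    {f. bij_betw f (carrier M) (carrier N) \<and>
        (\<forall>x\<in>carrier M. \<forall>y\<in>carrier M. f (x \<oplus>\<^bsub>M\<^esub> y) = f x \<oplus>\<^bsub>N\<^esub> f y) \<and>
        (\<forall>a\<in>carrier R. \<forall>x\<in>carrier M. f (a \<odot>\<^bsub>M\<^esub> x) = a \<odot>\<^bsub>N\<^esub> f x)}"

definition right_module_isomorphic ::
    "('a, 'm) ring_scheme \<Rightarrow> ('a, 'b) module \<Rightarrow> ('a, 'c) module \<Rightarrow> bool"
  where "right_module_isomorphic R M N \<longleftrightarrow> right_module_iso R M N \<noteq> {}"

definition ascending_chain ::
    "('a, 'm) ring_scheme \<Rightarrow> ('a, 'b) module \<Rightarrow> (nat \<Rightarrow> 'b set) \<Rightarrow> bool"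
  where "ascending_chain R M C \<longleftrightarrow> (\<forall>i. submodule (C i) R M \<and> C i \<subseteq> C (Suc i))"

text \<open>
  \<open>n_dim R M \<alpha>\<close> means that \<open>M\<close> has Noetherian dimension equal to \<open>\<alpha>\<close>.

  Ordinals are the elements of a well-ordered type \<open>'o\<close>, whose least element plays the role
  of \<open>-1\<close>, its successor that of \<open>0\<close>, and so on.  As \<open>'o\<close> is arbitrary, every ordinal
  arises in this way.

  The factor \<open>C (i + 1) / C i\<close> has carrier type \<open>'b set\<close>, whereas the recursion must
  stay at type \<open>'b\<close>; it is therefore applied to an isomorphic copy \<open>Q\<close> of the factor with
  carrier type \<open>'b\<close>.  Such a copy always exists (\<open>quotient_copy_ex\<close>), its choice is
  irrelevant (\<open>n_dim_isomorphic\<close>), and the recursion holds verbatim for the factors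
  themselves (\<open>n_dim_bottom\<close>, \<open>n_dim_rec\<close>).
\<close>

context notes conj_cong [fundef_cong] begin

function n_dim ::
    "('a, 'm) ring_scheme \<Rightarrow> ('a, 'b) module \<Rightarrow> 'o :: wellorder \<Rightarrow> bool"
  where "n_dim R M \<alpha> \<longleftrightarrow>
    (if \<forall>\<beta>. \<not> \<beta> < \<alpha> then carrier M = {\<zero>\<^bsub>M\<^esub>}
     else (\<forall>\<beta>. \<beta> < \<alpha> \<longrightarrow> \<not> n_dim R M \<beta>) \<and>
          (\<forall>C. ascending_chain R M C \<longrightarrow>
            (\<exists>k. \<forall>i\<ge>k. \<exists>\<beta>. \<beta> < \<alpha> \<and>
              (\<exists>Q :: ('a, 'b) module. right_module R Q \<and>
                right_module_isomorphic R
                  (quotient_module (M\<lparr>carrier := C (Suc i)\<rparr>) (C i)) Q \<and>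
                n_dim R Q \<beta>))))"
  by pat_completeness auto
termination
  by (relation "inv_image {(\<beta>, \<alpha>). \<beta> < \<alpha>} (\<lambda>(R, M, \<alpha>). \<alpha>)") (auto intro: wf)

end

declare n_dim.simps [simp del]

definition n_dim_le ::
    "('a, 'm) ring_scheme \<Rightarrow> ('a, 'b) module \<Rightarrow> 'o :: wellorder \<Rightarrow> bool"
  where "n_dim_le R M \<alpha> \<longleftrightarrow> (\<exists>\<beta>\<le>\<alpha>. n_dim R M \<beta>)"

text \<open>
  A downward directed family of submodules enters only through its (nonempty) range,
  so that directed sets of submodules suffice.
\<close>

definition AB5_star :: "('a, 'm) ring_scheme \<Rightarrow> ('a, 'b) module \<Rightarrow> bool"
  where "AB5_star R M \<longleftrightarrow>
    (\<forall>B \<A>. submodule B R M \<and> \<A> \<noteq> {} \<and> (\<forall>A\<in>\<A>. submodule A R M) \<and>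
        (\<forall>A\<^sub>1\<in>\<A>. \<forall>A\<^sub>2\<in>\<A>. \<exists>A\<in>\<A>. A \<subseteq> A\<^sub>1 \<and> A \<subseteq> A\<^sub>2) \<longrightarrow>
      B <+>\<^bsub>M\<^esub> (\<Inter>A\<in>\<A>. A) = (\<Inter>A\<in>\<A>. B <+>\<^bsub>M\<^esub> A))"

subsection \<open>The recursion in terms of the factors themselves\<close>

lemma right_module_surj_image:
  fixes M :: "('a, 'b) module" and N :: "('a, 'c) module"
  assumes M: "right_module R M"
    and im: "f ` carrier M = carrier N"
    and z: "f \<zero>\<^bsub>M\<^esub> = \<zero>\<^bsub>N\<^esub>"
    and ad: "\<And>x y. \<lbrakk>x \<in> carrier M; y \<in> carrier M\<rbrakk> \<Longrightarrow> f (x \<oplus>\<^bsub>M\<^esub> y) = f x \<oplus>\<^bsub>N\<^esub> f y"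
    and sm: "\<And>a x. \<lbrakk>a \<in> carrier R; x \<in> carrier M\<rbrakk> \<Longrightarrow> f (a \<odot>\<^bsub>M\<^esub> x) = a \<odot>\<^bsub>N\<^esub> f x"
  shows "right_module R N"
proof -
  interpret M: right_module R M by (rule M)
  have fc: "x \<in> carrier M \<Longrightarrow> f x \<in> carrier N" for x using im by auto
  have ex: "\<exists>x\<in>carrier M. y = f x" if "y \<in> carrier N" for y using im that by auto
  have AG: "abelian_group N"
  proof (rule abelian_groupI)
    fix x y assume "x \<in> carrier N" "y \<in> carrier N"
    then obtain u v where "u \<in> carrier M" "x = f u" "v \<in> carrier M" "y = f v" using ex by blast
    then show "x \<oplus>\<^bsub>N\<^esub> y \<in> carrier N" "x \<oplus>\<^bsub>N\<^esub> y = y \<oplus>\<^bsub>N\<^esub> x"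
      using fc[of "u \<oplus>\<^bsub>M\<^esub> v"] by (simp_all add: ad[symmetric] M.M.a_comm)
  next
    show "\<zero>\<^bsub>N\<^esub> \<in> carrier N" using fc[of "\<zero>\<^bsub>M\<^esub>"] z by simp
  next
    fix x y w assume "x \<in> carrier N" "y \<in> carrier N" "w \<in> carrier N"
    then obtain u v t where "u \<in> carrier M" "x = f u" "v \<in> carrier M" "y = f v"
      "t \<in> carrier M" "w = f t" using ex by metis
    then show "x \<oplus>\<^bsub>N\<^esub> y \<oplus>\<^bsub>N\<^esub> w = x \<oplus>\<^bsub>N\<^esub> (y \<oplus>\<^bsub>N\<^esub> w)"
      by (simp add: ad[symmetric] M.M.a_assoc)
  next
    fix x assume "x \<in> carrier N"
    then obtain u where u: "u \<in> carrier M" "x = f u" using ex by blast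
    then show "\<zero>\<^bsub>N\<^esub> \<oplus>\<^bsub>N\<^esub> x = x" by (simp add: z[symmetric] ad[symmetric])
    have "f (\<ominus>\<^bsub>M\<^esub> u) \<oplus>\<^bsub>N\<^esub> x = \<zero>\<^bsub>N\<^esub>"
      using u by (simp add: ad[symmetric] M.M.l_neg z)
    then show "\<exists>y\<in>carrier N. y \<oplus>\<^bsub>N\<^esub> x = \<zero>\<^bsub>N\<^esub>" using u fc by blast
  qed
  show ?thesis
  proof (intro right_module.intro right_module_axioms.intro)
    show "ring R" by (rule M.R.ring_axioms)
    show "abelian_group N" by (rule AG)
  next
    fix a x assume "a \<in> carrier R" "x \<in> carrier N"
    moreover from this obtain u where "u \<in> carrier M" "x = f u" using ex by blast
    ultimately show "a \<odot>\<^bsub>N\<^esub> x \<in> carrier N" using fc[of "a \<odot>\<^bsub>M\<^esub> u"] by (simp add: sm[symmetric])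
  next
    fix a b x assume "a \<in> carrier R" "b \<in> carrier R" "x \<in> carrier N"
    moreover from this obtain u where "u \<in> carrier M" "x = f u" using ex by blast
    ultimately show "(a \<oplus>\<^bsub>R\<^esub> b) \<odot>\<^bsub>N\<^esub> x = a \<odot>\<^bsub>N\<^esub> x \<oplus>\<^bsub>N\<^esub> b \<odot>\<^bsub>N\<^esub> x"
      and "b \<odot>\<^bsub>N\<^esub> (a \<odot>\<^bsub>N\<^esub> x) = (a \<otimes>\<^bsub>R\<^esub> b) \<odot>\<^bsub>N\<^esub> x"
      by (simp_all add: sm[symmetric] ad[symmetric] M.smult_l_distr M.smult_assoc)
  next
    fix a x y assume "a \<in> carrier R" "x \<in> carrier N" "y \<in> carrier N"
    moreover from this obtain u v where "u \<in> carrier M" "x = f u" "v \<in> carrier M" "y = f v"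
      using ex by blast
    ultimately show "a \<odot>\<^bsub>N\<^esub> (x \<oplus>\<^bsub>N\<^esub> y) = a \<odot>\<^bsub>N\<^esub> x \<oplus>\<^bsub>N\<^esub> a \<odot>\<^bsub>N\<^esub> y"
      by (simp add: sm[symmetric] ad[symmetric] M.smult_r_distr)
  next
    fix x assume "x \<in> carrier N"
    then obtain u where "u \<in> carrier M" "x = f u" using ex by blast
    then show "\<one>\<^bsub>R\<^esub> \<odot>\<^bsub>N\<^esub> x = x" by (simp add: sm[symmetric])
  qed
qed

lemma right_module_transport:
  fixes M :: "('a, 'b) module" and f :: "'b \<Rightarrow> 'c"
  assumes M: "right_module R M" and inj: "inj_on f (carrier M)"
  shows "\<exists>N :: ('a, 'c) module. right_module R N \<and> f \<in> right_module_iso R M N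
    \<and> carrier N = f ` carrier M"
proof -
  interpret M: right_module R M by (rule M)
  define g where "g = inv_into (carrier M) f"
  define N :: "('a, 'c) module" where "N = \<lparr>carrier = f ` carrier M, mult = undefined, one = undefined,
    zero = f \<zero>\<^bsub>M\<^esub>, add = (\<lambda>x y. f (g x \<oplus>\<^bsub>M\<^esub> g y)), smult = (\<lambda>a x. f (a \<odot>\<^bsub>M\<^esub> g x))\<rparr>"
  have g: "x \<in> carrier M \<Longrightarrow> g (f x) = x" for x using inj by (simp add: g_def)
  have "right_module R N"
    by (rule right_module_surj_image[OF M, of f]) (auto simp: N_def g)
  moreover have "f \<in> right_module_iso R M N"
    using inj by (auto simp: right_module_iso_def N_def g bij_betw_def)
  moreover have "carrier N = f ` carrier M" by (simp add: N_def)
  ultimately show ?thesis by blast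
qed

lemma right_module_iso_zero:
  assumes "right_module R M" "right_module R N" "f \<in> right_module_iso R M N"
  shows "f \<zero>\<^bsub>M\<^esub> = \<zero>\<^bsub>N\<^esub>"
proof -
  interpret M: right_module R M by fact
  interpret N: right_module R N by fact
  have c: "f \<zero>\<^bsub>M\<^esub> \<in> carrier N"
    using assms(3) by (auto simp: right_module_iso_def bij_betw_def)
  have "f (\<zero>\<^bsub>M\<^esub> \<oplus>\<^bsub>M\<^esub> \<zero>\<^bsub>M\<^esub>) = f \<zero>\<^bsub>M\<^esub> \<oplus>\<^bsub>N\<^esub> f \<zero>\<^bsub>M\<^esub>"
    using assms(3) M.M.zero_closed unfolding right_module_iso_def by blast
  then have "f \<zero>\<^bsub>M\<^esub> \<oplus>\<^bsub>N\<^esub> f \<zero>\<^bsub>M\<^esub> = f \<zero>\<^bsub>M\<^esub>" by simp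
  then show ?thesis using c N.M.add.l_cancel_one by blast
qed

lemma right_module_iso_sym:
  assumes M: "right_module R M" and f: "f \<in> right_module_iso R M N"
  shows "inv_into (carrier M) f \<in> right_module_iso R N M"
proof -
  interpret M: right_module R M by (rule M)
  let ?g = "inv_into (carrier M) f"
  have b: "bij_betw f (carrier M) (carrier N)" using f by (simp add: right_module_iso_def)
  have g: "x \<in> carrier M \<Longrightarrow> ?g (f x) = x" for x using b by (simp add: bij_betw_def)
  have ex: "\<exists>x\<in>carrier M. y = f x" if "y \<in> carrier N" for y using b that by (auto simp: bij_betw_def)
  have "?g (x \<oplus>\<^bsub>N\<^esub> y) = ?g x \<oplus>\<^bsub>M\<^esub> ?g y" if xy: "x \<in> carrier N" "y \<in> carrier N" for x y
  proof -
    obtain u v where uv: "u \<in> carrier M" "x = f u" "v \<in> carrier M" "y = f v" using ex xy by blast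
    then have "x \<oplus>\<^bsub>N\<^esub> y = f (u \<oplus>\<^bsub>M\<^esub> v)" using f by (simp add: right_module_iso_def)
    then show ?thesis using uv by (simp add: g)
  qed
  moreover have "?g (a \<odot>\<^bsub>N\<^esub> x) = a \<odot>\<^bsub>M\<^esub> ?g x" if ax: "a \<in> carrier R" "x \<in> carrier N" for a x
  proof -
    obtain u where u: "u \<in> carrier M" "x = f u" using ex ax by blast
    then have "a \<odot>\<^bsub>N\<^esub> x = f (a \<odot>\<^bsub>M\<^esub> u)" using f ax by (simp add: right_module_iso_def)
    then show ?thesis using u ax by (simp add: g)
  qed
  ultimately show ?thesis using bij_betw_inv_into[OF b] by (simp add: right_module_iso_def)
qed

lemma right_module_isomorphic_sym:
  "right_module R M \<Longrightarrow> right_module_isomorphic R M N \<Longrightarrow> right_module_isomorphic R N M"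
  using right_module_iso_sym unfolding right_module_isomorphic_def by blast

lemma right_module_isomorphic_trans:
  assumes "right_module_isomorphic R M N" "right_module_isomorphic R N P"
  shows "right_module_isomorphic R M P"
proof -
  from assms obtain f g where f: "f \<in> right_module_iso R M N" and g: "g \<in> right_module_iso R N P"
    unfolding right_module_isomorphic_def by blast
  have "x \<in> carrier M \<Longrightarrow> f x \<in> carrier N" for x
    using f by (auto simp: right_module_iso_def bij_betw_def)
  then have "g \<circ> f \<in> right_module_iso R M P"
    using f g by (auto simp: right_module_iso_def intro: bij_betw_trans)
  then show ?thesis unfolding right_module_isomorphic_def by blast
qed

lemma right_module_submodule_is_module:
  assumes M: "right_module R M" and H: "submodule H R M"
  shows "right_module R (M\<lparr>carrier := H\<rparr>)"
proof -
  interpret M: right_module R M by (rule M)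
  interpret H: submodule H R M by (rule H)
  have Hs: "x \<in> H \<Longrightarrow> x \<in> carrier M" for x using H.subset by auto
  have ag: "abelian_group (M\<lparr>carrier := H\<rparr>)"
  proof (rule abelian_groupI, goal_cases)
    case (6 x)
    then have "\<ominus>\<^bsub>M\<^esub> x \<in> H" using H.m_inv_closed[of x] by (simp add: a_inv_def)
    then show ?case using 6 Hs M.M.l_neg by auto
  qed (use H.m_closed H.one_closed Hs M.M.a_assoc M.M.a_comm in simp_all)
  show ?thesis
    by (intro right_module.intro right_module_axioms.intro M.R.ring_axioms ag)
      (simp_all add: Hs M.smult_l_distr M.smult_r_distr M.smult_assoc)
qed

lemma submodule_restrict:
  assumes A: "submodule A R M" and B: "submodule B R M" and AB: "A \<subseteq> B"
    and M: "right_module R M"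
  shows "submodule A R (M\<lparr>carrier := B\<rparr>)"
proof -
  interpret M: right_module R M by (rule M)
  interpret A: submodule A R M by (rule A)
  have "subgroup A ((add_monoid M)\<lparr>carrier := B\<rparr>)"
    using group.subgroup_incl[OF M.M.a_group _ _ AB] A.subgroup_axioms B
    by (simp add: submodule_def)
  then show ?thesis
    by (intro submodule.intro submodule_axioms.intro) auto
qed

lemma quotient_module_right_module:
  assumes M: "right_module R M" and A: "submodule A R M"
  shows "right_module R (quotient_module M A)"
proof -
  interpret M: right_module R M by (rule M)
  interpret A: submodule A R M by (rule A)
  interpret A': abelian_subgroup A M
    by (rule abelian_subgroupI3) (auto intro: additive_subgroup.intro A.subgroup_axioms M.M.abelian_group_axioms)
  show ?thesis
  proof (rule right_module_surj_image[OF M, of "\<lambda>x. A +>\<^bsub>M\<^esub> x"])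
    show "(\<lambda>x. A +>\<^bsub>M\<^esub> x) ` carrier M = carrier (quotient_module M A)"
      by (auto simp: quotient_module_def A_RCOSETS_def')
    show "A +>\<^bsub>M\<^esub> \<zero>\<^bsub>M\<^esub> = \<zero>\<^bsub>quotient_module M A\<^esub>"
      using A'.a_subset by (simp add: quotient_module_def)
    show "A +>\<^bsub>M\<^esub> (x \<oplus>\<^bsub>M\<^esub> y) = (A +>\<^bsub>M\<^esub> x) \<oplus>\<^bsub>quotient_module M A\<^esub> (A +>\<^bsub>M\<^esub> y)"
      if "x \<in> carrier M" "y \<in> carrier M" for x y
      using that A'.a_rcos_sum by (simp add: quotient_module_def)
    show "A +>\<^bsub>M\<^esub> (a \<odot>\<^bsub>M\<^esub> x) = a \<odot>\<^bsub>quotient_module M A\<^esub> (A +>\<^bsub>M\<^esub> x)"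
      if ax: "a \<in> carrier R" "x \<in> carrier M" for a x
    proof -
      have "A +>\<^bsub>M\<^esub> (a \<odot>\<^bsub>M\<^esub> y) = A +>\<^bsub>M\<^esub> (a \<odot>\<^bsub>M\<^esub> x)" if y: "y \<in> A +>\<^bsub>M\<^esub> x" for y
      proof -
        obtain h where h: "h \<in> A" "y = h \<oplus>\<^bsub>M\<^esub> x" using y by (auto simp: a_r_coset_def')
        have hM: "h \<in> carrier M" using h A'.a_subset by blast
        have "a \<odot>\<^bsub>M\<^esub> y = a \<odot>\<^bsub>M\<^esub> h \<oplus>\<^bsub>M\<^esub> a \<odot>\<^bsub>M\<^esub> x"
          using h hM ax by (simp add: M.smult_r_distr)
        then have "a \<odot>\<^bsub>M\<^esub> y \<in> A +>\<^bsub>M\<^esub> (a \<odot>\<^bsub>M\<^esub> x)"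
          using A.smult_closed[OF ax(1) h(1)] by (auto simp: a_r_coset_def')
        then show ?thesis
          using M.M.a_repr_independence[OF _ _ A'.a_subgroup] ax M.smult_closed by metis
      qed
      moreover have "x \<in> A +>\<^bsub>M\<^esub> x" using ax A'.a_rcos_self by blast
      ultimately have "(\<Union>y\<in>A +>\<^bsub>M\<^esub> x. A +>\<^bsub>M\<^esub> (a \<odot>\<^bsub>M\<^esub> y)) = A +>\<^bsub>M\<^esub> (a \<odot>\<^bsub>M\<^esub> x)"
        by blast
      then show ?thesis by (simp add: quotient_module_def)
    qed
  qed
qed

text \<open>Choosing coset representatives gives a copy on the original carrier type.\<close>

lemma quotient_copy_ex:
  fixes M :: "('a, 'b) module"
  assumes M: "right_module R M" and A: "submodule A R M"
  shows "\<exists>Q :: ('a, 'b) module. right_module R Q \<and>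
    right_module_isomorphic R (quotient_module M A) Q"
proof -
  interpret M: right_module R M by (rule M)
  interpret A: submodule A R M by (rule A)
  interpret A': abelian_subgroup A M
    by (rule abelian_subgroupI3) (auto intro: additive_subgroup.intro A.subgroup_axioms M.M.abelian_group_axioms)
  define r :: "'b set \<Rightarrow> 'b" where "r Z = (SOME x. x \<in> Z)" for Z
  have r: "r Z \<in> Z" if "Z \<in> a_rcosets\<^bsub>M\<^esub> A" for Z
  proof -
    obtain x where "x \<in> carrier M" "Z = A +>\<^bsub>M\<^esub> x" using \<open>Z \<in> _\<close> by (auto simp: A_RCOSETS_def')
    then have "x \<in> Z" using A'.a_rcos_self by blast
    then show ?thesis unfolding r_def by (rule someI)
  qed
  have "inj_on r (carrier (quotient_module M A))"
  proof (rule inj_onI)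
    fix Z W assume "Z \<in> carrier (quotient_module M A)" "W \<in> carrier (quotient_module M A)" "r Z = r W"
    then have ZW: "Z \<in> a_rcosets\<^bsub>M\<^esub> A" "W \<in> a_rcosets\<^bsub>M\<^esub> A" "r Z = r W"
      by (simp_all add: quotient_module_def)
    then have "r Z \<in> Z \<inter> W" using r[of Z] r[of W] by simp
    then show "Z = W" using A'.a_rcos_disjoint ZW(1,2) by (auto simp: pairwise_def disjnt_def)
  qed
  from right_module_transport[OF quotient_module_right_module[OF M A] this]
  show ?thesis unfolding right_module_isomorphic_def by blast
qed

lemma submodule_iso_image:
  assumes M: "right_module R M" and N: "right_module R N" and f: "f \<in> right_module_iso R M N"
    and H: "submodule H R M"
  shows "submodule (f ` H) R N"
proof -
  interpret M: right_module R M by (rule M)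
  interpret N: right_module R N by (rule N)
  interpret H: submodule H R M by (rule H)
  have Hs: "x \<in> H \<Longrightarrow> x \<in> carrier M" for x using H.subset by auto
  have fc: "x \<in> carrier M \<Longrightarrow> f x \<in> carrier N" for x
    using f by (auto simp: right_module_iso_def bij_betw_def)
  have ad: "f x \<oplus>\<^bsub>N\<^esub> f y = f (x \<oplus>\<^bsub>M\<^esub> y)" if "x \<in> carrier M" "y \<in> carrier M" for x y
    using f that by (simp add: right_module_iso_def)
  have sm: "a \<odot>\<^bsub>N\<^esub> f x = f (a \<odot>\<^bsub>M\<^esub> x)" if "a \<in> carrier R" "x \<in> carrier M" for a x
    using f that by (simp add: right_module_iso_def)
  have z: "f \<zero>\<^bsub>M\<^esub> = \<zero>\<^bsub>N\<^esub>" by (rule right_module_iso_zero[OF M N f])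
  have "subgroup (f ` H) (add_monoid N)"
  proof (rule group.subgroupI[OF N.M.a_group])
    show "f ` H \<subseteq> carrier (add_monoid N)" using Hs fc by auto
    show "f ` H \<noteq> {}" using H.one_closed by auto
  next
    fix y assume "y \<in> f ` H"
    then obtain x where x: "x \<in> H" "y = f x" by blast
    have ix: "\<ominus>\<^bsub>M\<^esub> x \<in> H" using H.m_inv_closed[of x] x by (simp add: a_inv_def)
    have "f (\<ominus>\<^bsub>M\<^esub> x) \<oplus>\<^bsub>N\<^esub> y = \<zero>\<^bsub>N\<^esub>"
      using x Hs by (simp add: ad z M.M.l_neg)
    then have "\<ominus>\<^bsub>N\<^esub> y = f (\<ominus>\<^bsub>M\<^esub> x)"
      using N.M.minus_equality x ix Hs fc by metis
    then show "inv\<^bsub>add_monoid N\<^esub> y \<in> f ` H" using ix by (simp add: a_inv_def)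
  next
    fix y y' assume "y \<in> f ` H" "y' \<in> f ` H"
    then obtain x x' where x: "x \<in> H" "y = f x" "x' \<in> H" "y' = f x'" by blast
    then have "x \<oplus>\<^bsub>M\<^esub> x' \<in> H" using H.m_closed by simp
    then show "y \<otimes>\<^bsub>add_monoid N\<^esub> y' \<in> f ` H" using x Hs by (auto simp: ad)
  qed
  then show ?thesis
    using sm Hs by (intro submodule.intro submodule_axioms.intro) (auto simp: image_iff)
qed

lemma factor_isomorphic:
  assumes M: "right_module R M" and N: "right_module R N" and f: "f \<in> right_module_iso R M N"
    and A: "submodule A R M" and B: "submodule B R M" and AB: "A \<subseteq> B"
  shows "right_module_isomorphic R (quotient_module (M\<lparr>carrier := B\<rparr>) A)
    (quotient_module (N\<lparr>carrier := f ` B\<rparr>) (f ` A))"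
proof -
  interpret M: right_module R M by (rule M)
  interpret B: submodule B R M by (rule B)
  have Bs: "x \<in> B \<Longrightarrow> x \<in> carrier M" for x using B.subset by auto
  have As: "x \<in> A \<Longrightarrow> x \<in> carrier M" for x using AB Bs by auto
  have inj: "inj_on f (carrier M)" using f by (simp add: right_module_iso_def bij_betw_def)
  have ad: "f (x \<oplus>\<^bsub>M\<^esub> y) = f x \<oplus>\<^bsub>N\<^esub> f y" if "x \<in> carrier M" "y \<in> carrier M" for x y
    using f that by (simp add: right_module_iso_def)
  have sm: "f (a \<odot>\<^bsub>M\<^esub> x) = a \<odot>\<^bsub>N\<^esub> f x" if "a \<in> carrier R" "x \<in> carrier M" for a x
    using f that by (simp add: right_module_iso_def)
  have cos: "f ` (\<Union>h\<in>A. {h \<oplus>\<^bsub>M\<^esub> x}) = (\<Union>h\<in>f ` A. {h \<oplus>\<^bsub>N\<^esub> f x})" if "x \<in> carrier M" for x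
    using that by (auto simp: ad As image_iff)
  have sub: "Z \<subseteq> carrier M" if "Z \<in> (\<Union>a\<in>B. {\<Union>h\<in>A. {h \<oplus>\<^bsub>M\<^esub> a}})" for Z
    using that Bs As by auto
  let ?Q = "quotient_module (M\<lparr>carrier := B\<rparr>) A"
  let ?P = "quotient_module (N\<lparr>carrier := f ` B\<rparr>) (f ` A)"
  note defs = quotient_module_def A_RCOSETS_def' a_r_coset_def' set_add_def'
  have "(\<lambda>Z. f ` Z) \<in> right_module_iso R ?Q ?P"
    unfolding right_module_iso_def
  proof (intro CollectI conjI ballI)
    have "inj_on (\<lambda>Z. f ` Z) (carrier ?Q)"
    proof (rule inj_onI)
      fix Z W assume "Z \<in> carrier ?Q" "W \<in> carrier ?Q" and e: "f ` Z = f ` W"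
      then have "Z \<subseteq> carrier M" "W \<subseteq> carrier M" by (auto simp: defs Bs As)
      then show "Z = W" using e inj inj_on_image_eq_iff by metis
    qed
    moreover have "(\<lambda>Z. f ` Z) ` carrier ?Q = carrier ?P"
    proof -
      have "(\<lambda>Z. f ` Z) ` carrier ?Q = (\<Union>a\<in>B. {f ` (\<Union>h\<in>A. {h \<oplus>\<^bsub>M\<^esub> a})})"
        by (auto simp: defs)
      also have "\<dots> = (\<Union>a\<in>B. {\<Union>h\<in>f ` A. {h \<oplus>\<^bsub>N\<^esub> f a}})"
        by (intro SUP_cong refl) (simp add: cos Bs)
      also have "\<dots> = carrier ?P" by (auto simp: defs)
      finally show ?thesis .
    qed
    ultimately show "bij_betw (\<lambda>Z. f ` Z) (carrier ?Q) (carrier ?P)" by (simp add: bij_betw_def)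
  next
    fix Z W assume "Z \<in> carrier ?Q" "W \<in> carrier ?Q"
    then have "Z \<subseteq> carrier M" "W \<subseteq> carrier M" by (auto simp: defs Bs As)
    then have "f ` (\<Union>h\<in>Z. \<Union>k\<in>W. {h \<oplus>\<^bsub>M\<^esub> k}) = (\<Union>h\<in>Z. \<Union>k\<in>W. {f h \<oplus>\<^bsub>N\<^esub> f k})"
      unfolding image_UN by (intro SUP_cong refl) (simp add: ad subset_iff)
    then show "f ` (Z \<oplus>\<^bsub>?Q\<^esub> W) = f ` Z \<oplus>\<^bsub>?P\<^esub> f ` W"
      by (simp add: defs)
  next
    fix a Z assume a: "a \<in> carrier R" and "Z \<in> carrier ?Q"
    then have Z: "Z \<subseteq> carrier M" by (auto simp: defs Bs As)
    have "f ` (\<Union>x\<in>Z. \<Union>h\<in>A. {h \<oplus>\<^bsub>M\<^esub> a \<odot>\<^bsub>M\<^esub> x}) = (\<Union>x\<in>Z. \<Union>h\<in>f ` A. {h \<oplus>\<^bsub>N\<^esub> a \<odot>\<^bsub>N\<^esub> f x})"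
      unfolding image_UN[of f _ Z]
    proof (intro SUP_cong refl)
      fix x assume "x \<in> Z"
      then have "x \<in> carrier M" using Z by blast
      then show "f ` (\<Union>h\<in>A. {h \<oplus>\<^bsub>M\<^esub> a \<odot>\<^bsub>M\<^esub> x}) = (\<Union>h\<in>f ` A. {h \<oplus>\<^bsub>N\<^esub> a \<odot>\<^bsub>N\<^esub> f x})"
        using a cos[of "a \<odot>\<^bsub>M\<^esub> x"] by (simp add: sm)
    qed
    then show "f ` (a \<odot>\<^bsub>?Q\<^esub> Z) = a \<odot>\<^bsub>?P\<^esub> f ` Z"
      by (simp add: defs)
  qed
  then show ?thesis unfolding right_module_isomorphic_def by blast
qed

lemma ascending_chain_image:
  assumes "right_module R M" "right_module R N" "f \<in> right_module_iso R M N"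
    and "ascending_chain R M C"
  shows "ascending_chain R N (\<lambda>i. f ` C i)"
  using assms submodule_iso_image unfolding ascending_chain_def by blast

lemma chain_factor_right_module:
  assumes "right_module R M" "ascending_chain R M C"
  shows "right_module R (M\<lparr>carrier := C (Suc i)\<rparr>)" "submodule (C i) R (M\<lparr>carrier := C (Suc i)\<rparr>)"
    "right_module R (quotient_module (M\<lparr>carrier := C (Suc i)\<rparr>) (C i))"
proof -
  have C: "submodule (C i) R M" "submodule (C (Suc i)) R M" "C i \<subseteq> C (Suc i)"
    using assms(2) by (auto simp: ascending_chain_def)
  show 1: "right_module R (M\<lparr>carrier := C (Suc i)\<rparr>)"
    by (rule right_module_submodule_is_module[OF assms(1) C(2)])
  show 2: "submodule (C i) R (M\<lparr>carrier := C (Suc i)\<rparr>)"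
    by (rule submodule_restrict[OF C assms(1)])
  show "right_module R (quotient_module (M\<lparr>carrier := C (Suc i)\<rparr>) (C i))"
    by (rule quotient_module_right_module[OF 1 2])
qed

lemma n_dim_isomorphic_imp:
  fixes M :: "('a, 'b) module" and N :: "('a, 'c) module" and \<alpha> :: "'o :: wellorder"
  assumes IH: "\<And>\<beta> (M :: ('a, 'b) module) (N :: ('a, 'c) module). \<lbrakk>\<beta> < \<alpha>; right_module R M;
      right_module R N; right_module_isomorphic R M N\<rbrakk> \<Longrightarrow> n_dim R M \<beta> \<longleftrightarrow> n_dim R N \<beta>"
    and M: "right_module R M" and N: "right_module R N"
    and MN: "right_module_isomorphic R M N" and d: "n_dim R M \<alpha>"
  shows "n_dim R N \<alpha>"
proof -
  interpret M: right_module R M by (rule M)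
  obtain f where f: "f \<in> right_module_iso R M N"
    using MN unfolding right_module_isomorphic_def by blast
  have b: "bij_betw f (carrier M) (carrier N)" using f by (simp add: right_module_iso_def)
  note z = right_module_iso_zero[OF M N f]
  show ?thesis
  proof (cases "\<forall>\<beta>. \<not> \<beta> < \<alpha>")
    case True
    with d have "carrier M = {\<zero>\<^bsub>M\<^esub>}" by (simp add: n_dim.simps[of R M \<alpha>])
    then have "carrier N = {\<zero>\<^bsub>N\<^esub>}" using b z by (auto simp: bij_betw_def)
    with True show ?thesis by (simp add: n_dim.simps[of R N \<alpha>])
  next
    case False
    have d1: "\<And>\<beta>. \<beta> < \<alpha> \<Longrightarrow> \<not> n_dim R M \<beta>"
      and d2: "\<And>C. ascending_chain R M C \<Longrightarrow> \<exists>k. \<forall>i\<ge>k. \<exists>\<beta>. \<beta> < \<alpha> \<and>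
        (\<exists>Q :: ('a, 'b) module. right_module R Q \<and> right_module_isomorphic R
           (quotient_module (M\<lparr>carrier := C (Suc i)\<rparr>) (C i)) Q \<and> n_dim R Q \<beta>)"
      using d False by (auto simp only: n_dim.simps[of R M \<alpha>] if_False)
    have e1: "\<not> n_dim R N \<beta>" if "\<beta> < \<alpha>" for \<beta>
      using d1[OF that] IH[OF that M N MN] by simp
    have e2: "\<exists>k. \<forall>i\<ge>k. \<exists>\<beta>. \<beta> < \<alpha> \<and>
        (\<exists>Q :: ('a, 'c) module. right_module R Q \<and> right_module_isomorphic R
           (quotient_module (N\<lparr>carrier := C (Suc i)\<rparr>) (C i)) Q \<and> n_dim R Q \<beta>)"
      if C: "ascending_chain R N C" for C
    proof -
      define g where "g = inv_into (carrier M) f"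
      have g: "g \<in> right_module_iso R N M"
        unfolding g_def by (rule right_module_iso_sym[OF M f])
      note ch = ascending_chain_image[OF N M g C]
      from d2[OF this] obtain k where k: "\<And>i. i \<ge> k \<Longrightarrow> \<exists>\<beta>. \<beta> < \<alpha> \<and>
        (\<exists>Q :: ('a, 'b) module. right_module R Q \<and> right_module_isomorphic R
           (quotient_module (M\<lparr>carrier := g ` C (Suc i)\<rparr>) (g ` C i)) Q \<and> n_dim R Q \<beta>)" by blast
      have "\<exists>\<beta>. \<beta> < \<alpha> \<and>
        (\<exists>Q :: ('a, 'c) module. right_module R Q \<and> right_module_isomorphic R
           (quotient_module (N\<lparr>carrier := C (Suc i)\<rparr>) (C i)) Q \<and> n_dim R Q \<beta>)" if "i \<ge> k" for i
      proof -
        let ?F = "quotient_module (N\<lparr>carrier := C (Suc i)\<rparr>) (C i)"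
        let ?G = "quotient_module (M\<lparr>carrier := g ` C (Suc i)\<rparr>) (g ` C i)"
        obtain \<beta> and Q :: "('a, 'b) module" where Q: "\<beta> < \<alpha>" "right_module R Q"
          "right_module_isomorphic R ?G Q" "n_dim R Q \<beta>" using k[OF \<open>i \<ge> k\<close>] by blast
        have FG: "right_module_isomorphic R ?F ?G"
          using factor_isomorphic[OF N M g, of "C i" "C (Suc i)"] C by (auto simp: ascending_chain_def)
        note F = chain_factor_right_module[OF N C, of i]
        obtain P :: "('a, 'c) module" where P: "right_module R P" "right_module_isomorphic R ?F P"
          using quotient_copy_ex[OF F(1,2)] by blast
        have "right_module_isomorphic R Q P"
          using right_module_isomorphic_sym[OF F(3) right_module_isomorphic_trans[OF FG Q(3)]]
            P(2) right_module_isomorphic_trans by blast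
        then have "n_dim R P \<beta>" using IH[OF Q(1) Q(2) P(1)] Q(4) by simp
        then show ?thesis using P Q(1) by blast
      qed
      then show ?thesis by blast
    qed
    show ?thesis unfolding n_dim.simps[of R N \<alpha>] if_not_P[OF False] using e1 e2 by blast
  qed
qed

theorem n_dim_isomorphic:
  fixes M :: "('a, 'b) module" and N :: "('a, 'c) module" and \<alpha> :: "'o :: wellorder"
  assumes "right_module R M" "right_module R N" "right_module_isomorphic R M N"
  shows "n_dim R M \<alpha> \<longleftrightarrow> n_dim R N \<alpha>"
  using assms
proof (induction \<alpha> arbitrary: M N rule: less_induct)
  case (less \<alpha>)
  have IH': "n_dim R M' \<beta> \<longleftrightarrow> n_dim R N' \<beta>" if "\<beta> < \<alpha>" "right_module R M'" "right_module R N'"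
    "right_module_isomorphic R M' N'" for \<beta> and M' :: "('a, 'c) module" and N' :: "('a, 'b) module"
    using less.IH[OF that(1) that(3) that(2) right_module_isomorphic_sym[OF that(2) that(4)]] by simp
  have "n_dim R M \<alpha> \<Longrightarrow> n_dim R N \<alpha>"
    by (rule n_dim_isomorphic_imp[OF less.IH less.prems])
  moreover have "n_dim R N \<alpha> \<Longrightarrow> n_dim R M \<alpha>"
    by (rule n_dim_isomorphic_imp[OF IH' less.prems(2) less.prems(1)
          right_module_isomorphic_sym[OF less.prems(1,3)]])
  ultimately show ?case by blast
qed

theorem n_dim_bottom:
  "\<forall>\<beta>. \<not> \<beta> < \<alpha> \<Longrightarrow> n_dim R M \<alpha> \<longleftrightarrow> carrier M = {\<zero>\<^bsub>M\<^esub>}"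
  by (simp add: n_dim.simps[of R M \<alpha>])

theorem n_dim_rec:
  fixes \<alpha> :: "'o :: wellorder" and M :: "('a, 'b) module"
  assumes M: "right_module R M" and \<alpha>: "\<exists>\<beta>. \<beta> < \<alpha>"
  shows "n_dim R M \<alpha> \<longleftrightarrow>
    (\<forall>\<beta>. \<beta> < \<alpha> \<longrightarrow> \<not> n_dim R M \<beta>) \<and>
    (\<forall>C. ascending_chain R M C \<longrightarrow> (\<exists>k. \<forall>i\<ge>k. \<exists>\<beta>. \<beta> < \<alpha> \<and>
      n_dim R (quotient_module (M\<lparr>carrier := C (Suc i)\<rparr>) (C i)) \<beta>))"
proof -
  have *: "(\<exists>Q :: ('a, 'b) module. right_module R Q \<and> right_module_isomorphic R
        (quotient_module (M\<lparr>carrier := C (Suc i)\<rparr>) (C i)) Q \<and> n_dim R Q \<beta>) \<longleftrightarrow>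
      n_dim R (quotient_module (M\<lparr>carrier := C (Suc i)\<rparr>) (C i)) \<beta>"
    if C: "ascending_chain R M C" for C i and \<beta> :: 'o
    using n_dim_isomorphic[OF chain_factor_right_module(3)[OF M C]]
      quotient_copy_ex[OF chain_factor_right_module(1,2)[OF M C]] by blast
  have nb: "\<not> (\<forall>\<beta>. \<not> \<beta> < \<alpha>)" using \<alpha> by blast
  show ?thesis
    unfolding n_dim.simps[of R M \<alpha>] if_not_P[OF nb] by (simp only: * cong: imp_cong)
qed

end

theory Submission
  imports Defs "HOL-Library.Nat_Bijection"
begin

text \<open>
  Noetherian dimension depends only on the lattice of submodules: the dimension of \<open>B/A\<close> is
  the deviation, with respect to ascending chains, of the interval from \<open>A\<close> to \<open>B\<close>
  (\<open>n_dim_le_factor_iff\<close>).  The whole argument therefore takes place in this lattice.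
  Strictly monotone maps between intervals replace the isomorphism theorems and exact sequences;
  for instance \<open>X \<mapsto> (X + K, X \<inter> K + N)\<close> shows that \<open>M/(K \<inter> N)\<close> has dimension at most \<open>\<alpha>\<close>
  if \<open>M/K\<close> and \<open>M/N\<close> have.  So the family may be closed under finite intersections, and
  becomes an inverse system \<open>\<A>\<close>.

  The case \<open>\<alpha> = -1\<close> is trivial.  Let \<open>\<alpha> \<ge> 0\<close> and suppose that \<open>M/\<Inter>\<A>\<close> does not have dimension
  at most \<open>\<alpha>\<close>.  Then there is a chain
  \<open>C\<^sub>0 \<subseteq> C\<^sub>1 \<subseteq> \<dots>\<close> above \<open>\<Inter>\<A>\<close> with infinitely many factors not of dimension below
  \<open>\<alpha>\<close>.  For \<open>A \<in> \<A>\<close> the factors of \<open>C\<^sub>i + A\<close> do eventually have dimension below \<open>\<alpha>\<close>,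
  so that for infinitely many \<open>i\<close> some element of \<open>C\<^sub>i\<^sub>+\<^sub>1 \<inter> A\<close> lies outside \<open>C\<^sub>i\<close>.
  By AB5* we have \<open>C\<^sub>i = \<Inter>{C\<^sub>i + A' |A'. A' \<in> \<A>}\<close>, and such an element even
  lies outside \<open>C\<^sub>i + A'\<close> for some \<open>A' \<subseteq> A\<close> in \<open>\<A>\<close> (\<open>AB5_star_separation\<close>).  Repeating
  this with \<open>A'\<close> in place of \<open>A\<close> and ever larger indices \<open>i\<close> gives elements
  \<open>d\<^sub>j\<close> and submodules \<open>G\<^sub>j\<close> of the form \<open>C\<^sub>i + A'\<close> such that \<open>d\<^sub>j \<in> G\<^sub>i\<close> if and only
  if \<open>i \<noteq> j\<close>: the \<open>d\<^sub>j\<close> generate an infinite direct sum modulo the intersection of the \<open>G\<^sub>j\<close>.  A module with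
  Noetherian dimension, whatever its value, has no such subquotient
  (\<open>codev_le_no_independent_sequence\<close>).
\<close>

section \<open>Dual deviation of intervals in a family of sets\<close>

definition chain_between :: "'b set set \<Rightarrow> 'b set \<Rightarrow> 'b set \<Rightarrow> (nat \<Rightarrow> 'b set) \<Rightarrow> bool"
  where "chain_between L A B C \<longleftrightarrow> (\<forall>i. C i \<in> L \<and> A \<subseteq> C i \<and> C i \<subseteq> C (Suc i) \<and> C i \<subseteq> B)"

text \<open>
  The deviation of the interval from \<open>A\<close> to \<open>B\<close> in \<open>(L, \<supseteq>)\<close> is at most \<open>\<alpha>\<close>.  Bounding the
  deviation, instead of fixing its value, leaves only positive recursive occurrences, as an
  inductive definition requires.  The least \<open>\<alpha>\<close> stands for \<open>-1\<close>: the second rule then never applies to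
  \<open>A \<in> L\<close> with \<open>A \<subseteq> B\<close>, since the constant chain refutes its premise.
\<close>

inductive codev_le :: "'b set set \<Rightarrow> 'b set \<Rightarrow> 'b set \<Rightarrow> 'o :: wellorder \<Rightarrow> bool"
  for L :: "'b set set"
  where
    codev_le_refl: "codev_le L A A \<alpha>"
  | codev_le_chain: "(\<And>C. chain_between L A B C \<Longrightarrow>
        \<exists>k. \<forall>i\<ge>k. \<exists>\<beta>. \<beta> < \<alpha> \<and> codev_le L (C i) (C (Suc i)) \<beta>) \<Longrightarrow> codev_le L A B \<alpha>"

lemma codev_le_iff:
  "codev_le L A B \<alpha> \<longleftrightarrow> A = B \<or> (\<forall>C. chain_between L A B C \<longrightarrow>
    (\<exists>k. \<forall>i\<ge>k. \<exists>\<beta>. \<beta> < \<alpha> \<and> codev_le L (C i) (C (Suc i)) \<beta>))"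
  by (subst codev_le.simps) blast

lemma codev_le_mono:
  assumes "codev_le L A B \<beta>" "\<beta> \<le> \<alpha>"
  shows "codev_le L A B \<alpha>"
  using assms unfolding codev_le_iff[of L A B] by (meson less_le_trans)

lemma codev_le_chainD:
  assumes "codev_le L A B \<alpha>" "\<gamma> < \<alpha>" "chain_between L A B C"
  shows "\<exists>k. \<forall>i\<ge>k. \<exists>\<beta>. \<beta> < \<alpha> \<and> codev_le L (C i) (C (Suc i)) \<beta>"
proof (cases "A = B")
  case True
  then have "C i = A" for i using assms(3) by (auto simp: chain_between_def)
  then show ?thesis using assms(2) codev_le_refl by metis
next
  case False
  then show ?thesis using assms(1,3) by (simp add: codev_le_iff[of L A B])
qed

lemma codev_le_bottomD:
  assumes "codev_le L A B \<alpha>" "\<And>\<beta>. \<not> \<beta> < \<alpha>" "A \<in> L" "A \<subseteq> B"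
  shows "A = B"
proof -
  have "chain_between L A B (\<lambda>_. A)" using assms by (simp add: chain_between_def)
  then show ?thesis using assms(1,2) by (subst (asm) codev_le_iff) blast
qed

text \<open>
  The image of a chain under each of the two maps is eventually small, and the maps restrict to the
  factors of the chain, so the claim descends along the ordinal.  Applied to lattices of submodules
  this yields both monotonicity along embeddings and closure under extensions.
\<close>

lemma codev_le_subdirect:
  fixes \<alpha> :: "'o :: wellorder"
  assumes "codev_le L A\<^sub>1 B\<^sub>1 \<alpha>" "codev_le L A\<^sub>2 B\<^sub>2 \<alpha>" "A\<^sub>1 \<in> L" "A\<^sub>2 \<in> L" "A \<in> L" "B \<in> L" "A \<subseteq> B"
    and \<phi>\<^sub>1: "\<And>X. \<lbrakk>X \<in> L; A \<subseteq> X; X \<subseteq> B\<rbrakk> \<Longrightarrow> \<phi>\<^sub>1 X \<in> L \<and> A\<^sub>1 \<subseteq> \<phi>\<^sub>1 X \<and> \<phi>\<^sub>1 X \<subseteq> B\<^sub>1"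
    and \<phi>\<^sub>2: "\<And>X. \<lbrakk>X \<in> L; A \<subseteq> X; X \<subseteq> B\<rbrakk> \<Longrightarrow> \<phi>\<^sub>2 X \<in> L \<and> A\<^sub>2 \<subseteq> \<phi>\<^sub>2 X \<and> \<phi>\<^sub>2 X \<subseteq> B\<^sub>2"
    and mono: "\<And>X Y. \<lbrakk>X \<in> L; Y \<in> L; A \<subseteq> X; X \<subseteq> Y; Y \<subseteq> B\<rbrakk> \<Longrightarrow> \<phi>\<^sub>1 X \<subseteq> \<phi>\<^sub>1 Y \<and> \<phi>\<^sub>2 X \<subseteq> \<phi>\<^sub>2 Y"
    and inj: "\<And>X Y. \<lbrakk>X \<in> L; Y \<in> L; A \<subseteq> X; X \<subseteq> Y; Y \<subseteq> B; \<phi>\<^sub>1 X = \<phi>\<^sub>1 Y; \<phi>\<^sub>2 X = \<phi>\<^sub>2 Y\<rbrakk> \<Longrightarrow> X = Y"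
  shows "codev_le L A B \<alpha>"
  using assms
proof (induction \<alpha> arbitrary: A B A\<^sub>1 B\<^sub>1 A\<^sub>2 B\<^sub>2 rule: less_induct)
  case (less \<alpha>)
  note A\<^sub>1 = less.prems(3) and A\<^sub>2 = less.prems(4) and AB = less.prems(5-7)
    and map = less.prems(8,9) and mono = less.prems(10) and inj = less.prems(11)
  show ?case
  proof (cases "\<exists>\<gamma>. \<gamma> < \<alpha>")
    case False
    have ends: "A\<^sub>1 \<subseteq> \<phi>\<^sub>1 A" "\<phi>\<^sub>1 A \<subseteq> \<phi>\<^sub>1 B" "\<phi>\<^sub>1 B \<subseteq> B\<^sub>1" "A\<^sub>2 \<subseteq> \<phi>\<^sub>2 A" "\<phi>\<^sub>2 A \<subseteq> \<phi>\<^sub>2 B" "\<phi>\<^sub>2 B \<subseteq> B\<^sub>2"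
      using map[of A] map[of B] mono[of A B] AB by auto
    have "A\<^sub>1 = B\<^sub>1"
      by (rule codev_le_bottomD[OF less.prems(1)]) (use False A\<^sub>1 ends in auto)
    moreover have "A\<^sub>2 = B\<^sub>2"
      by (rule codev_le_bottomD[OF less.prems(2)]) (use False A\<^sub>2 ends in auto)
    ultimately have "A = B" using ends inj[of A B] AB by blast
    then show ?thesis by (simp add: codev_le_refl)
  next
    case True
    then obtain \<gamma> where \<gamma>: "\<gamma> < \<alpha>" ..
    show ?thesis
    proof (rule codev_le_chain)
      fix C assume C: "chain_between L A B C"
      then have C': "C i \<in> L" "A \<subseteq> C i" "C i \<subseteq> C (Suc i)" "C i \<subseteq> B" for i
        by (auto simp: chain_between_def)
      have "chain_between L A\<^sub>1 B\<^sub>1 (\<lambda>i. \<phi>\<^sub>1 (C i))" "chain_between L A\<^sub>2 B\<^sub>2 (\<lambda>i. \<phi>\<^sub>2 (C i))"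
        unfolding chain_between_def using C' map mono by meson+
      then obtain k l
        where k: "\<And>i. i \<ge> k \<Longrightarrow> \<exists>\<beta>. \<beta> < \<alpha> \<and> codev_le L (\<phi>\<^sub>1 (C i)) (\<phi>\<^sub>1 (C (Suc i))) \<beta>"
          and l: "\<And>i. i \<ge> l \<Longrightarrow> \<exists>\<beta>. \<beta> < \<alpha> \<and> codev_le L (\<phi>\<^sub>2 (C i)) (\<phi>\<^sub>2 (C (Suc i))) \<beta>"
        using codev_le_chainD[OF less.prems(1) \<gamma>] codev_le_chainD[OF less.prems(2) \<gamma>] by metis
      have "\<exists>\<beta>. \<beta> < \<alpha> \<and> codev_le L (C i) (C (Suc i)) \<beta>" if i: "i \<ge> max k l" for i
      proof -
        obtain \<beta>\<^sub>1 \<beta>\<^sub>2 where \<beta>: "\<beta>\<^sub>1 < \<alpha>" "codev_le L (\<phi>\<^sub>1 (C i)) (\<phi>\<^sub>1 (C (Suc i))) \<beta>\<^sub>1"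
          "\<beta>\<^sub>2 < \<alpha>" "codev_le L (\<phi>\<^sub>2 (C i)) (\<phi>\<^sub>2 (C (Suc i))) \<beta>\<^sub>2"
          using k[of i] l[of i] i by auto
        have "codev_le L (C i) (C (Suc i)) (max \<beta>\<^sub>1 \<beta>\<^sub>2)"
        proof (rule less.IH)
          show "max \<beta>\<^sub>1 \<beta>\<^sub>2 < \<alpha>" using \<beta> by simp
          show "codev_le L (\<phi>\<^sub>1 (C i)) (\<phi>\<^sub>1 (C (Suc i))) (max \<beta>\<^sub>1 \<beta>\<^sub>2)"
            "codev_le L (\<phi>\<^sub>2 (C i)) (\<phi>\<^sub>2 (C (Suc i))) (max \<beta>\<^sub>1 \<beta>\<^sub>2)"
            using codev_le_mono[OF \<beta>(2)] codev_le_mono[OF \<beta>(4)] by simp_all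
          show "\<phi>\<^sub>1 (C i) \<in> L" "\<phi>\<^sub>2 (C i) \<in> L" using map C' by auto
          fix X assume X: "X \<in> L" "C i \<subseteq> X" "X \<subseteq> C (Suc i)"
          have AX: "A \<subseteq> X" "X \<subseteq> B" using X C'[of i] C'[of "Suc i"] by auto
          show "\<phi>\<^sub>1 X \<in> L \<and> \<phi>\<^sub>1 (C i) \<subseteq> \<phi>\<^sub>1 X \<and> \<phi>\<^sub>1 X \<subseteq> \<phi>\<^sub>1 (C (Suc i))"
            "\<phi>\<^sub>2 X \<in> L \<and> \<phi>\<^sub>2 (C i) \<subseteq> \<phi>\<^sub>2 X \<and> \<phi>\<^sub>2 X \<subseteq> \<phi>\<^sub>2 (C (Suc i))"
            using map[of X] mono[of "C i" X] mono[of X "C (Suc i)"] X AX C'[of i] C'[of "Suc i"]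
            by auto
        next
          fix X Y assume XY: "X \<in> L" "Y \<in> L" "C i \<subseteq> X" "X \<subseteq> Y" "Y \<subseteq> C (Suc i)"
          have AX: "A \<subseteq> X" "Y \<subseteq> B" using XY C'[of i] C'[of "Suc i"] by auto
          then show "\<phi>\<^sub>1 X \<subseteq> \<phi>\<^sub>1 Y \<and> \<phi>\<^sub>2 X \<subseteq> \<phi>\<^sub>2 Y" using mono XY by blast
          assume "\<phi>\<^sub>1 X = \<phi>\<^sub>1 Y" "\<phi>\<^sub>2 X = \<phi>\<^sub>2 Y"
          then show "X = Y" using inj XY AX by blast
        qed (use C' in auto)
        then show ?thesis using \<beta> by (intro exI[of _ "max \<beta>\<^sub>1 \<beta>\<^sub>2"]) simp
      qed
      then show "\<exists>k. \<forall>i\<ge>k. \<exists>\<beta>. \<beta> < \<alpha> \<and> codev_le L (C i) (C (Suc i)) \<beta>" by blast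
    qed
  qed
qed

lemma codev_le_embedding:
  assumes "codev_le L A' B' \<alpha>" "A' \<in> L" "A \<in> L" "B \<in> L" "A \<subseteq> B"
    and "\<And>X. \<lbrakk>X \<in> L; A \<subseteq> X; X \<subseteq> B\<rbrakk> \<Longrightarrow> \<phi> X \<in> L \<and> A' \<subseteq> \<phi> X \<and> \<phi> X \<subseteq> B'"
    and "\<And>X Y. \<lbrakk>X \<in> L; Y \<in> L; A \<subseteq> X; X \<subseteq> Y; Y \<subseteq> B\<rbrakk> \<Longrightarrow> \<phi> X \<subseteq> \<phi> Y"
    and "\<And>X Y. \<lbrakk>X \<in> L; Y \<in> L; A \<subseteq> X; X \<subseteq> Y; Y \<subseteq> B; \<phi> X = \<phi> Y\<rbrakk> \<Longrightarrow> X = Y"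
  shows "codev_le L A B \<alpha>"
proof (rule codev_le_subdirect[OF assms(1,1,2,2,3,4,5), of \<phi> \<phi>])
  fix X Y assume "X \<in> L" "Y \<in> L" "A \<subseteq> X" "X \<subseteq> Y" "Y \<subseteq> B"
  then show "\<phi> X \<subseteq> \<phi> Y \<and> \<phi> X \<subseteq> \<phi> Y" by (intro conjI assms(7))
qed (rule assms(6,8); assumption)+

text \<open>
  The elements \<open>d j\<close> are independent modulo the intersection of the \<open>G j\<close>.  Stating this by means
  of separating members of \<open>L\<close>, and not by sums, keeps it within a family of sets that is closed
  under intersections.
\<close>

definition independent_sequence ::
    "'b set set \<Rightarrow> 'b set \<Rightarrow> 'b set \<Rightarrow> (nat \<Rightarrow> 'b set) \<Rightarrow> (nat \<Rightarrow> 'b) \<Rightarrow> bool"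
  where "independent_sequence L A B G d \<longleftrightarrow> A \<subseteq> B \<and> B \<in> L \<and>
    (\<forall>j. G j \<in> L \<and> A \<subseteq> G j \<and> d j \<in> B) \<and> (\<forall>i j. d j \<in> G i \<longleftrightarrow> i \<noteq> j)"

text \<open>
  Splitting the index set into infinitely many infinite rows and letting in one row after the other
  produces a chain each of whose factors again contains an independent sequence.  By induction
  none of these factors has a deviation.
\<close>

lemma codev_le_no_independent_sequence:
  assumes "codev_le L A B \<alpha>" and Int: "\<And>\<A>. \<lbrakk>\<A> \<subseteq> L; \<A> \<noteq> {}\<rbrakk> \<Longrightarrow> \<Inter>\<A> \<in> L"
  shows "\<not> independent_sequence L A B G d"
  using assms(1)
proof (induction arbitrary: G d rule: codev_le.induct)
  case (codev_le_refl A \<alpha>)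
  then show ?case unfolding independent_sequence_def by blast
next
  case (codev_le_chain A B \<alpha>)
  show ?case
  proof
    assume "independent_sequence L A B G d"
    then have AB: "A \<subseteq> B" "B \<in> L" and G: "\<And>j. G j \<in> L" "\<And>j. A \<subseteq> G j"
      and d: "\<And>j. d j \<in> B" "\<And>i j. d j \<in> G i \<longleftrightarrow> i \<noteq> j"
      unfolding independent_sequence_def by blast+
    \<comment> \<open>Row \<open>m\<close> consists of the indices \<open>prod_encode (m, n)\<close>; \<open>E m\<close> contains exactly the
      \<open>d j\<close> with \<open>j\<close> in a row before \<open>m\<close>.\<close>
    define row where "row n = fst (prod_decode n)" for n
    define E where "E m = \<Inter>(insert B {G j |j. m \<le> row j})" for m
    have E_eq: "E m = {x \<in> B. \<forall>j. m \<le> row j \<longrightarrow> x \<in> G j}" for m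
      unfolding E_def by blast
    have E_L: "E m \<in> L" for m unfolding E_def by (rule Int) (use AB G in auto)
    have "A \<subseteq> E m" "E m \<subseteq> E (Suc m)" "E m \<subseteq> B" for m
      using AB G(2) by (auto simp: E_eq)
    then have "chain_between L A B E" using E_L by (simp add: chain_between_def)
    from codev_le_chain.IH[OF this] obtain m where
      IH: "\<And>G d. \<not> independent_sequence L (E m) (E (Suc m)) G d"
      by blast
    define G' d' where "G' n = G (prod_encode (m, n))" and "d' n = d (prod_encode (m, n))" for n
    have "d' n \<in> E (Suc m)" for n
      using d by (auto simp: E_eq row_def d'_def)
    moreover have "E m \<subseteq> G' n" for n
      by (auto simp: E_eq row_def G'_def)
    moreover have "d' n \<in> G' l \<longleftrightarrow> l \<noteq> n" for l n
      using d(2) by (simp add: d'_def G'_def)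
    moreover have "E m \<subseteq> E (Suc m)" by (auto simp: E_eq)
    moreover have "G' n \<in> L" for n using G by (simp add: G'_def)
    ultimately have "independent_sequence L (E m) (E (Suc m)) G' d'"
      using E_L unfolding independent_sequence_def by blast
    with IH show False by blast
  qed
qed

section \<open>The lattice of submodules\<close>

context right_module
begin

lemma smult_zero_left:
  assumes "x \<in> carrier M"
  shows "\<zero>\<^bsub>R\<^esub> \<odot>\<^bsub>M\<^esub> x = \<zero>\<^bsub>M\<^esub>"
proof -
  have "\<zero>\<^bsub>R\<^esub> \<odot>\<^bsub>M\<^esub> x \<oplus>\<^bsub>M\<^esub> \<zero>\<^bsub>R\<^esub> \<odot>\<^bsub>M\<^esub> x = \<zero>\<^bsub>R\<^esub> \<odot>\<^bsub>M\<^esub> x"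
    using assms by (simp flip: smult_l_distr)
  then show ?thesis using assms M.add.l_cancel_one by simp
qed

lemma smult_minus_one:
  assumes "x \<in> carrier M"
  shows "(\<ominus>\<^bsub>R\<^esub> \<one>\<^bsub>R\<^esub>) \<odot>\<^bsub>M\<^esub> x = \<ominus>\<^bsub>M\<^esub> x"
proof -
  have "(\<ominus>\<^bsub>R\<^esub> \<one>\<^bsub>R\<^esub>) \<odot>\<^bsub>M\<^esub> x \<oplus>\<^bsub>M\<^esub> \<one>\<^bsub>R\<^esub> \<odot>\<^bsub>M\<^esub> x = \<zero>\<^bsub>M\<^esub>"
    using assms by (simp add: smult_zero_left R.l_neg flip: smult_l_distr del: smult_one)
  then show ?thesis using assms M.minus_equality[of "(\<ominus>\<^bsub>R\<^esub> \<one>\<^bsub>R\<^esub>) \<odot>\<^bsub>M\<^esub> x" x] by simp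
qed

text \<open>Closure under negation is closure under the scalar \<open>-1\<close>.\<close>

lemma submodule_iff:
  "submodule H R M \<longleftrightarrow> H \<subseteq> carrier M \<and> \<zero>\<^bsub>M\<^esub> \<in> H \<and>
    (\<forall>x\<in>H. \<forall>y\<in>H. x \<oplus>\<^bsub>M\<^esub> y \<in> H) \<and> (\<forall>a\<in>carrier R. \<forall>x\<in>H. a \<odot>\<^bsub>M\<^esub> x \<in> H)"
  (is "_ \<longleftrightarrow> ?closed")
proof
  assume "submodule H R M"
  then interpret H: submodule H R M .
  show ?closed using H.subset H.one_closed H.m_closed by auto
next
  assume H: ?closed
  have "\<ominus>\<^bsub>M\<^esub> x \<in> H" if "x \<in> H" for x
  proof -
    have "(\<ominus>\<^bsub>R\<^esub> \<one>\<^bsub>R\<^esub>) \<odot>\<^bsub>M\<^esub> x \<in> H" using H that by simp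
    moreover have "x \<in> carrier M" using H that by blast
    ultimately show ?thesis using smult_minus_one[of x] by simp
  qed
  then have "subgroup H (add_monoid M)"
    using H by (intro group.subgroupI[OF M.a_group]) (auto simp: a_inv_def)
  then show "submodule H R M"
    using H by (intro submodule.intro submodule_axioms.intro) auto
qed

lemma submodule_minus_closed:
  assumes "submodule H R M" "x \<in> H" "y \<in> H"
  shows "x \<ominus>\<^bsub>M\<^esub> y \<in> H"
proof -
  have H: "H \<subseteq> carrier M" "\<And>x y. x \<in> H \<Longrightarrow> y \<in> H \<Longrightarrow> x \<oplus>\<^bsub>M\<^esub> y \<in> H"
    "\<And>a x. a \<in> carrier R \<Longrightarrow> x \<in> H \<Longrightarrow> a \<odot>\<^bsub>M\<^esub> x \<in> H"
    using assms(1) by (auto simp: submodule_iff)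
  have "(\<ominus>\<^bsub>R\<^esub> \<one>\<^bsub>R\<^esub>) \<odot>\<^bsub>M\<^esub> y \<in> H" using H(3) assms(3) by simp
  moreover have "y \<in> carrier M" using H(1) assms(3) by blast
  ultimately have "\<ominus>\<^bsub>M\<^esub> y \<in> H" using smult_minus_one[of y] by simp
  then show ?thesis using H(2) assms(2) by (simp add: a_minus_def)
qed

lemma submodule_carrier: "submodule (carrier M) R M"
  by (simp add: submodule_iff)

lemma submodule_zero: "submodule {\<zero>\<^bsub>M\<^esub>} R M"
proof -
  have "a \<odot>\<^bsub>M\<^esub> \<zero>\<^bsub>M\<^esub> = \<zero>\<^bsub>M\<^esub>" if "a \<in> carrier R" for a
  proof -
    have "a \<odot>\<^bsub>M\<^esub> \<zero>\<^bsub>M\<^esub> \<oplus>\<^bsub>M\<^esub> a \<odot>\<^bsub>M\<^esub> \<zero>\<^bsub>M\<^esub> = a \<odot>\<^bsub>M\<^esub> \<zero>\<^bsub>M\<^esub>"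
      using that by (simp flip: smult_r_distr)
    then show ?thesis using that M.add.l_cancel_one by simp
  qed
  then show ?thesis by (simp add: submodule_iff)
qed

lemma submodule_Inter:
  assumes "\<And>H. H \<in> \<H> \<Longrightarrow> submodule H R M" "\<H> \<noteq> {}"
  shows "submodule (\<Inter>\<H>) R M"
  using assms unfolding submodule_iff by blast

lemma mem_set_add: "x \<in> H <+>\<^bsub>M\<^esub> K \<longleftrightarrow> (\<exists>h\<in>H. \<exists>k\<in>K. x = h \<oplus>\<^bsub>M\<^esub> k)"
  by (auto simp: set_add_def')

lemma submodule_set_add:
  assumes "submodule H R M" "submodule K R M"
  shows "submodule (H <+>\<^bsub>M\<^esub> K) R M"
proof -
  have HK: "h \<in> carrier M" "k \<in> carrier M" if "h \<in> H" "k \<in> K" for h k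
    using assms that by (auto simp: submodule_iff)
  have add: "h \<oplus>\<^bsub>M\<^esub> h' \<in> H" "k \<oplus>\<^bsub>M\<^esub> k' \<in> K" if "h \<in> H" "h' \<in> H" "k \<in> K" "k' \<in> K" for h h' k k'
    using assms that by (auto simp: submodule_iff)
  have smult: "a \<odot>\<^bsub>M\<^esub> h \<in> H" "a \<odot>\<^bsub>M\<^esub> k \<in> K" if "a \<in> carrier R" "h \<in> H" "k \<in> K" for a h k
    using assms that by (auto simp: submodule_iff)
  show ?thesis
    unfolding submodule_iff
  proof (intro conjI ballI)
    show "H <+>\<^bsub>M\<^esub> K \<subseteq> carrier M" by (auto simp: mem_set_add HK)
    have "\<zero>\<^bsub>M\<^esub> \<in> H" "\<zero>\<^bsub>M\<^esub> \<in> K" using assms by (auto simp: submodule_iff)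
    then show "\<zero>\<^bsub>M\<^esub> \<in> H <+>\<^bsub>M\<^esub> K"
      unfolding mem_set_add by (intro bexI[of _ "\<zero>\<^bsub>M\<^esub>"]) simp_all
  next
    fix x y assume "x \<in> H <+>\<^bsub>M\<^esub> K" "y \<in> H <+>\<^bsub>M\<^esub> K"
    then obtain h k h' k' where hk: "h \<in> H" "k \<in> K" "x = h \<oplus>\<^bsub>M\<^esub> k" "h' \<in> H" "k' \<in> K" "y = h' \<oplus>\<^bsub>M\<^esub> k'"
      unfolding mem_set_add by blast
    then have "x \<oplus>\<^bsub>M\<^esub> y = (h \<oplus>\<^bsub>M\<^esub> h') \<oplus>\<^bsub>M\<^esub> (k \<oplus>\<^bsub>M\<^esub> k')"
      using HK[of h k] HK[of h' k'] by (simp add: M.a_ac)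
    then show "x \<oplus>\<^bsub>M\<^esub> y \<in> H <+>\<^bsub>M\<^esub> K" unfolding mem_set_add using add hk by blast
  next
    fix a x assume a: "a \<in> carrier R" and "x \<in> H <+>\<^bsub>M\<^esub> K"
    then obtain h k where hk: "h \<in> H" "k \<in> K" "x = h \<oplus>\<^bsub>M\<^esub> k"
      unfolding mem_set_add by blast
    then have "a \<odot>\<^bsub>M\<^esub> x = a \<odot>\<^bsub>M\<^esub> h \<oplus>\<^bsub>M\<^esub> a \<odot>\<^bsub>M\<^esub> k"
      using a HK[of h k] by (simp add: smult_r_distr)
    then show "a \<odot>\<^bsub>M\<^esub> x \<in> H <+>\<^bsub>M\<^esub> K" unfolding mem_set_add using smult a hk by blast
  qed
qed

lemma set_add_upper:
  assumes "submodule H R M" "submodule K R M"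
  shows "H \<subseteq> H <+>\<^bsub>M\<^esub> K" "K \<subseteq> H <+>\<^bsub>M\<^esub> K"
proof -
  have HK: "H \<subseteq> carrier M" "K \<subseteq> carrier M" "\<zero>\<^bsub>M\<^esub> \<in> H" "\<zero>\<^bsub>M\<^esub> \<in> K"
    using assms by (auto simp: submodule_iff)
  show "H \<subseteq> H <+>\<^bsub>M\<^esub> K"
  proof
    fix h assume h: "h \<in> H"
    then have "h = h \<oplus>\<^bsub>M\<^esub> \<zero>\<^bsub>M\<^esub>" using HK(1) by (simp add: subset_iff)
    then show "h \<in> H <+>\<^bsub>M\<^esub> K" using h HK(4) unfolding mem_set_add by blast
  qed
  show "K \<subseteq> H <+>\<^bsub>M\<^esub> K"
  proof
    fix k assume k: "k \<in> K"
    then have "k = \<zero>\<^bsub>M\<^esub> \<oplus>\<^bsub>M\<^esub> k" using HK(2) by (simp add: subset_iff)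
    then show "k \<in> H <+>\<^bsub>M\<^esub> K" using k HK(3) unfolding mem_set_add by blast
  qed
qed

lemma set_add_mono: "H \<subseteq> H' \<Longrightarrow> K \<subseteq> K' \<Longrightarrow> H <+>\<^bsub>M\<^esub> K \<subseteq> H' <+>\<^bsub>M\<^esub> K'"
  by (rule subsetI) (unfold mem_set_add, blast)

text \<open>The modular law for elements: \<open>(X + K) \<inter> Y = X + (K \<inter> Y)\<close> for \<open>X \<subseteq> Y\<close>.\<close>

lemma mem_set_addE:
  assumes "y \<in> X <+>\<^bsub>M\<^esub> K" "submodule X R M" "submodule K R M" "submodule Y R M" "X \<subseteq> Y" "y \<in> Y"
  obtains x n where "x \<in> X" "n \<in> K" "n \<in> Y" "y = x \<oplus>\<^bsub>M\<^esub> n"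
proof -
  obtain x n where xn: "x \<in> X" "n \<in> K" "y = x \<oplus>\<^bsub>M\<^esub> n" using assms(1) mem_set_add by blast
  then have "x \<in> carrier M" "n \<in> carrier M" using assms(2,3) by (auto simp: submodule_iff)
  then have "y \<ominus>\<^bsub>M\<^esub> x = n"
    using xn by (simp add: a_minus_def M.a_ac M.r_neg)
  then have "n \<in> Y" using submodule_minus_closed[OF assms(4,6), of x] xn assms(5) by blast
  then show ?thesis using that xn by blast
qed

text \<open>
  The last hypothesis says that \<open>B/A \<rightarrow> (B + K)/(A + K)\<close> is injective, hence an isomorphism.
\<close>

lemma codev_le_second_iso:
  assumes "codev_le {H. submodule H R M} (A <+>\<^bsub>M\<^esub> K) (B <+>\<^bsub>M\<^esub> K) \<beta>"
    and A: "submodule A R M" and B: "submodule B R M" and K: "submodule K R M"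
    and "A \<subseteq> B" "B \<inter> (A <+>\<^bsub>M\<^esub> K) \<subseteq> A"
  shows "codev_le {H. submodule H R M} A B \<beta>"
proof (rule codev_le_embedding[OF assms(1), where \<phi> = "\<lambda>X. X <+>\<^bsub>M\<^esub> K"])
  show "A <+>\<^bsub>M\<^esub> K \<in> {H. submodule H R M}" using A K submodule_set_add by simp
  show "X <+>\<^bsub>M\<^esub> K \<in> {H. submodule H R M} \<and> A <+>\<^bsub>M\<^esub> K \<subseteq> X <+>\<^bsub>M\<^esub> K \<and> X <+>\<^bsub>M\<^esub> K \<subseteq> B <+>\<^bsub>M\<^esub> K"
    if "X \<in> {H. submodule H R M}" "A \<subseteq> X" "X \<subseteq> B" for X
    using that K submodule_set_add set_add_mono by simp
next
  fix X Y assume XY: "X \<in> {H. submodule H R M}" "Y \<in> {H. submodule H R M}" "A \<subseteq> X" "X \<subseteq> Y" "Y \<subseteq> B"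
    and eq: "X <+>\<^bsub>M\<^esub> K = Y <+>\<^bsub>M\<^esub> K"
  have "y \<in> X" if y: "y \<in> Y" for y
  proof -
    have "y \<in> X <+>\<^bsub>M\<^esub> K" using y eq set_add_upper(1)[of Y K] XY K by auto
    then obtain x n where xn: "x \<in> X" "n \<in> K" "n \<in> Y" "y = x \<oplus>\<^bsub>M\<^esub> n"
      using mem_set_addE[of y X K Y] XY K y by blast
    then have "n \<in> A" using assms(6) set_add_upper(2)[OF A K] XY by blast
    then show ?thesis using xn XY by (auto simp: submodule_iff)
  qed
  then show "X = Y" using XY by blast
qed (use A B assms(5) set_add_mono in simp_all)

text \<open>
  Here \<open>K/(K \<inter> N)\<close> embeds in \<open>M/N\<close>, so \<open>M/(K \<inter> N)\<close> is an extension of a submodule of \<open>M/N\<close>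
  by \<open>M/K\<close>.  The two components of a submodule \<open>X\<close> in this extension are \<open>X + K\<close> and
  \<open>X \<inter> K + N\<close>; by modularity they determine \<open>X\<close> among comparable submodules.
\<close>

lemma codev_le_Int:
  assumes K: "submodule K R M" and N: "submodule N R M"
    and "codev_le {H. submodule H R M} K (carrier M) \<beta>"
    and "codev_le {H. submodule H R M} N (carrier M) \<beta>"
  shows "codev_le {H. submodule H R M} (K \<inter> N) (carrier M) \<beta>"
proof (rule codev_le_subdirect[OF assms(3,4),
      where \<phi>\<^sub>1 = "\<lambda>X. X <+>\<^bsub>M\<^esub> K" and \<phi>\<^sub>2 = "\<lambda>X. (X \<inter> K) <+>\<^bsub>M\<^esub> N"])
  have Int: "submodule (X \<inter> K) R M" if "submodule X R M" for X
    using that K submodule_Inter[of "{X, K}"] by auto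
  show "K \<in> {H. submodule H R M}" "N \<in> {H. submodule H R M}" using K N by simp_all
  show "K \<inter> N \<in> {H. submodule H R M}" using Int[OF N] by (simp add: Int_commute)
  show "carrier M \<in> {H. submodule H R M}" by (simp add: submodule_carrier)
  show "K \<inter> N \<subseteq> carrier M" using K by (auto simp: submodule_iff)
  fix X assume X: "X \<in> {H. submodule H R M}"
  have S: "submodule (X <+>\<^bsub>M\<^esub> K) R M" "submodule (X \<inter> K <+>\<^bsub>M\<^esub> N) R M"
    using X K N Int by (simp_all add: submodule_set_add)
  show "X <+>\<^bsub>M\<^esub> K \<in> {H. submodule H R M} \<and> K \<subseteq> X <+>\<^bsub>M\<^esub> K \<and> X <+>\<^bsub>M\<^esub> K \<subseteq> carrier M"
    using S(1) set_add_upper(2)[of X K] X K by (simp add: submodule_iff[of "X <+>\<^bsub>M\<^esub> K"])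
  show "X \<inter> K <+>\<^bsub>M\<^esub> N \<in> {H. submodule H R M} \<and> N \<subseteq> X \<inter> K <+>\<^bsub>M\<^esub> N \<and> X \<inter> K <+>\<^bsub>M\<^esub> N \<subseteq> carrier M"
    using S(2) set_add_upper(2)[of "X \<inter> K" N] X N Int by (simp add: submodule_iff[of "X \<inter> K <+>\<^bsub>M\<^esub> N"])
  fix Y assume XY: "Y \<in> {H. submodule H R M}" "K \<inter> N \<subseteq> X" "X \<subseteq> Y"
  show "X <+>\<^bsub>M\<^esub> K \<subseteq> Y <+>\<^bsub>M\<^esub> K \<and> X \<inter> K <+>\<^bsub>M\<^esub> N \<subseteq> Y \<inter> K <+>\<^bsub>M\<^esub> N"
    using XY by (intro conjI set_add_mono) auto
  assume eq: "X <+>\<^bsub>M\<^esub> K = Y <+>\<^bsub>M\<^esub> K" "X \<inter> K <+>\<^bsub>M\<^esub> N = Y \<inter> K <+>\<^bsub>M\<^esub> N"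
  have "y \<in> X" if y: "y \<in> Y" for y
  proof -
    have "y \<in> X <+>\<^bsub>M\<^esub> K" using y eq set_add_upper(1)[of Y K] XY K by auto
    then obtain x n where xn: "x \<in> X" "n \<in> K" "n \<in> Y" "y = x \<oplus>\<^bsub>M\<^esub> n"
      using mem_set_addE[of y X K Y] X XY K y by blast
    have "n \<in> X \<inter> K <+>\<^bsub>M\<^esub> N" using xn eq set_add_upper(1)[of "Y \<inter> K" N] XY Int N by auto
    then obtain x' m where m: "x' \<in> X \<inter> K" "m \<in> N" "m \<in> K" "n = x' \<oplus>\<^bsub>M\<^esub> m"
      using mem_set_addE[of n "X \<inter> K" N K] X K N Int xn by blast
    then have "n \<in> X" using X XY by (auto simp: submodule_iff)
    then show ?thesis using xn X by (auto simp: submodule_iff)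
  qed
  then show "X = Y" using XY by blast
qed

end

section \<open>Noetherian dimension of factors as dual deviation\<close>

locale right_module_epi = right_module R M + N: right_module R N
  for R :: "('a, 'm) ring_scheme" (structure)
    and M :: "('a, 'b) module" (structure) and N :: "('a, 'c) module" and f :: "'b \<Rightarrow> 'c" +
  assumes onto: "f ` carrier M = carrier N"
    and map_add: "\<lbrakk>x \<in> carrier M; y \<in> carrier M\<rbrakk> \<Longrightarrow> f (x \<oplus>\<^bsub>M\<^esub> y) = f x \<oplus>\<^bsub>N\<^esub> f y"
    and map_smult: "\<lbrakk>a \<in> carrier R; x \<in> carrier M\<rbrakk> \<Longrightarrow> f (a \<odot>\<^bsub>M\<^esub> x) = a \<odot>\<^bsub>N\<^esub> f x"
begin

lemma map_closed: "x \<in> carrier M \<Longrightarrow> f x \<in> carrier N"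
  using onto by blast

lemma map_zero: "f \<zero>\<^bsub>M\<^esub> = \<zero>\<^bsub>N\<^esub>"
proof -
  have "f \<zero>\<^bsub>M\<^esub> \<oplus>\<^bsub>N\<^esub> f \<zero>\<^bsub>M\<^esub> = f \<zero>\<^bsub>M\<^esub>"
    using map_add[of "\<zero>\<^bsub>M\<^esub>" "\<zero>\<^bsub>M\<^esub>"] by simp
  then show ?thesis using map_closed[of "\<zero>\<^bsub>M\<^esub>"] N.M.add.l_cancel_one by simp
qed

lemma submodule_image:
  assumes "submodule H R M"
  shows "submodule (f ` H) R N"
proof -
  have Hs: "x \<in> carrier M" if "x \<in> H" for x using assms that by (auto simp: submodule_iff)
  have add: "x \<oplus>\<^bsub>M\<^esub> y \<in> H" if "x \<in> H" "y \<in> H" for x y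
    using assms that by (simp add: submodule_iff)
  have smult: "a \<odot>\<^bsub>M\<^esub> x \<in> H" if "a \<in> carrier R" "x \<in> H" for a x
    using assms that by (simp add: submodule_iff)
  have "\<zero>\<^bsub>M\<^esub> \<in> H" using assms by (simp add: submodule_iff)
  then have "\<zero>\<^bsub>N\<^esub> \<in> f ` H" using map_zero by (metis imageI)
  moreover have "f x \<oplus>\<^bsub>N\<^esub> f y \<in> f ` H" if "x \<in> H" "y \<in> H" for x y
    using add[OF that] Hs that by (simp flip: map_add)
  moreover have "a \<odot>\<^bsub>N\<^esub> f x \<in> f ` H" if "a \<in> carrier R" "x \<in> H" for a x
    using smult[OF that] Hs that by (simp flip: map_smult)
  ultimately show ?thesis unfolding N.submodule_iff using Hs map_closed by blast
qed

lemma submodule_preimage: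
  assumes "submodule K R N"
  shows "submodule {x \<in> carrier M. f x \<in> K} R M"
  using assms by (simp add: submodule_iff N.submodule_iff map_zero map_add map_smult)

text \<open>
  The isomorphism sends a coset to its image under \<open>f\<close>.  It is injective because the cosets of a
  submodule that contains the kernel are saturated with respect to \<open>f\<close>.  For a quotient map \<open>f\<close>
  this is the third isomorphism theorem.
\<close>

lemma factor_isomorphic_image:
  assumes C: "submodule C R M" and D: "submodule D R M" and "C \<subseteq> D"
    and ker: "\<And>x. \<lbrakk>x \<in> carrier M; f x = \<zero>\<^bsub>N\<^esub>\<rbrakk> \<Longrightarrow> x \<in> C"
  shows "right_module_isomorphic R (quotient_module (M\<lparr>carrier := D\<rparr>) C)
    (quotient_module (N\<lparr>carrier := f ` D\<rparr>) (f ` C))"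
proof -
  have Ds: "x \<in> carrier M" if "x \<in> D" for x using D that by (auto simp: submodule_iff)
  have Cs: "x \<in> carrier M" if "x \<in> C" for x using \<open>C \<subseteq> D\<close> Ds that by blast
  have cos: "f ` (\<Union>h\<in>C. {h \<oplus>\<^bsub>M\<^esub> x}) = (\<Union>h\<in>f ` C. {h \<oplus>\<^bsub>N\<^esub> f x})" if "x \<in> carrier M" for x
    using that by (auto simp: map_add Cs image_iff)
  let ?Q = "quotient_module (M\<lparr>carrier := D\<rparr>) C"
  let ?P = "quotient_module (N\<lparr>carrier := f ` D\<rparr>) (f ` C)"
  note defs = quotient_module_def A_RCOSETS_def' a_r_coset_def' set_add_def'
  have sub: "Z \<subseteq> carrier M" if "Z \<in> carrier ?Q" for Z
    using that Ds Cs by (auto simp: defs)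
  have closed: "c \<oplus>\<^bsub>M\<^esub> c' \<in> C" if "c \<in> C" "c' \<in> C" for c c'
    using C that by (simp add: submodule_iff)
  have sat: "z \<in> W" if W: "W \<in> carrier ?Q" and z: "z \<in> carrier M" "f z \<in> f ` W" for z W
  proof -
    obtain y where y: "y \<in> D" "W = (\<Union>h\<in>C. {h \<oplus>\<^bsub>M\<^esub> y})" using W by (auto simp: defs)
    obtain c where c: "c \<in> C" "f z = f (c \<oplus>\<^bsub>M\<^esub> y)" using z(2) y(2) by blast
    have car: "c \<in> carrier M" "y \<in> carrier M" using c y Cs Ds by auto
    define w where "w = c \<oplus>\<^bsub>M\<^esub> y"
    have w: "w \<in> carrier M" "f z = f w" using car c by (simp_all add: w_def)
    have "f (z \<ominus>\<^bsub>M\<^esub> w) \<oplus>\<^bsub>N\<^esub> f w = f w"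
      using w z(1) by (simp add: a_minus_def M.a_assoc M.l_neg flip: map_add)
    then have "f (z \<ominus>\<^bsub>M\<^esub> w) = \<zero>\<^bsub>N\<^esub>"
      using w z(1) map_closed[of w] map_closed[of "z \<ominus>\<^bsub>M\<^esub> w"] N.M.add.r_cancel_one by simp
    then have zw: "z \<ominus>\<^bsub>M\<^esub> w \<in> C" using ker w z(1) by simp
    have "z = (z \<ominus>\<^bsub>M\<^esub> w) \<oplus>\<^bsub>M\<^esub> w" using w z(1) by (simp add: a_minus_def M.a_assoc M.l_neg)
    also have "\<dots> = ((z \<ominus>\<^bsub>M\<^esub> w) \<oplus>\<^bsub>M\<^esub> c) \<oplus>\<^bsub>M\<^esub> y"
      using zw Cs car by (simp add: w_def M.a_assoc)
    finally show ?thesis using closed[OF zw c(1)] y(2) by blast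
  qed
  have "(\<lambda>Z. f ` Z) \<in> right_module_iso R ?Q ?P"
    unfolding right_module_iso_def
  proof (intro CollectI conjI ballI)
    have "inj_on (\<lambda>Z. f ` Z) (carrier ?Q)"
    proof (rule inj_onI)
      fix Z W assume ZW: "Z \<in> carrier ?Q" "W \<in> carrier ?Q" "f ` Z = f ` W"
      have "Z \<subseteq> W" using ZW sub[of Z] sat[of W] by blast
      moreover have "W \<subseteq> Z" using ZW sub[of W] sat[of Z] by blast
      ultimately show "Z = W" by blast
    qed
    moreover have "(\<lambda>Z. f ` Z) ` carrier ?Q = carrier ?P"
    proof -
      have "(\<lambda>Z. f ` Z) ` carrier ?Q = (\<Union>a\<in>D. {f ` (\<Union>h\<in>C. {h \<oplus>\<^bsub>M\<^esub> a})})"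
        by (auto simp: defs)
      also have "\<dots> = (\<Union>a\<in>D. {\<Union>h\<in>f ` C. {h \<oplus>\<^bsub>N\<^esub> f a}})"
        by (intro SUP_cong refl) (simp add: cos Ds)
      also have "\<dots> = carrier ?P" by (auto simp: defs)
      finally show ?thesis .
    qed
    ultimately show "bij_betw (\<lambda>Z. f ` Z) (carrier ?Q) (carrier ?P)" by (simp add: bij_betw_def)
  next
    fix Z W assume "Z \<in> carrier ?Q" "W \<in> carrier ?Q"
    then have "Z \<subseteq> carrier M" "W \<subseteq> carrier M" by (simp_all add: sub)
    then have "f ` (\<Union>h\<in>Z. \<Union>k\<in>W. {h \<oplus>\<^bsub>M\<^esub> k}) = (\<Union>h\<in>Z. \<Union>k\<in>W. {f h \<oplus>\<^bsub>N\<^esub> f k})"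
      unfolding image_UN by (intro SUP_cong refl) (simp add: map_add subset_iff)
    then show "f ` (Z \<oplus>\<^bsub>?Q\<^esub> W) = f ` Z \<oplus>\<^bsub>?P\<^esub> f ` W"
      by (simp add: defs)
  next
    fix a Z assume a: "a \<in> carrier R" and "Z \<in> carrier ?Q"
    then have Z: "Z \<subseteq> carrier M" by (simp add: sub)
    have "f ` (\<Union>x\<in>Z. \<Union>h\<in>C. {h \<oplus>\<^bsub>M\<^esub> a \<odot>\<^bsub>M\<^esub> x}) = (\<Union>x\<in>Z. \<Union>h\<in>f ` C. {h \<oplus>\<^bsub>N\<^esub> a \<odot>\<^bsub>N\<^esub> f x})"
      unfolding image_UN[of f _ Z]
    proof (intro SUP_cong refl)
      fix x assume "x \<in> Z"
      then have "x \<in> carrier M" using Z by blast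
      then show "f ` (\<Union>h\<in>C. {h \<oplus>\<^bsub>M\<^esub> a \<odot>\<^bsub>M\<^esub> x}) = (\<Union>h\<in>f ` C. {h \<oplus>\<^bsub>N\<^esub> a \<odot>\<^bsub>N\<^esub> f x})"
        using a cos[of "a \<odot>\<^bsub>M\<^esub> x"] by (simp add: map_smult)
    qed
    then show "f ` (a \<odot>\<^bsub>?Q\<^esub> Z) = a \<odot>\<^bsub>?P\<^esub> f ` Z"
      by (simp add: defs)
  qed
  then show ?thesis unfolding right_module_isomorphic_def by blast
qed

end

text \<open>
  The clause of \<open>n_dim\<close> that excludes smaller values disappears for upper bounds: by well-ordering,
  the least \<open>\<beta>\<close> that satisfies the chain condition is the exact dimension.
\<close>

lemma n_dim_le_iff:
  fixes Q :: "('a, 'c) module" and \<alpha> :: "'o :: wellorder"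
  assumes Q: "right_module R Q"
  shows "n_dim_le R Q \<alpha> \<longleftrightarrow> carrier Q = {\<zero>\<^bsub>Q\<^esub>} \<or>
    (\<forall>C. ascending_chain R Q C \<longrightarrow> (\<exists>k. \<forall>i\<ge>k. \<exists>\<beta>. \<beta> < \<alpha> \<and>
      n_dim_le R (quotient_module (Q\<lparr>carrier := C (Suc i)\<rparr>) (C i)) \<beta>))"
proof -
  interpret Q: right_module R Q by (rule Q)
  define small where "small \<beta> \<longleftrightarrow> (\<forall>C. ascending_chain R Q C \<longrightarrow> (\<exists>k. \<forall>i\<ge>k. \<exists>\<gamma>. \<gamma> < \<beta> \<and>
      n_dim R (quotient_module (Q\<lparr>carrier := C (Suc i)\<rparr>) (C i)) \<gamma>))" for \<beta> :: 'o
  define P where "P \<beta> \<longleftrightarrow> carrier Q = {\<zero>\<^bsub>Q\<^esub>} \<or> small \<beta>" for \<beta>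
  have lt: "(\<exists>\<beta>. \<beta> < \<alpha> \<and> n_dim_le R X \<beta>) \<longleftrightarrow> (\<exists>\<beta>. \<beta> < \<alpha> \<and> n_dim R X \<beta>)"
    for X :: "('a, 'c set) module"
    unfolding n_dim_le_def by (meson le_less_trans order_refl)
  have small_mono: "small \<gamma>" if \<beta>: "small \<beta>" "\<beta> \<le> \<gamma>" for \<beta> \<gamma>
    unfolding small_def
  proof (intro allI impI)
    fix C assume "ascending_chain R Q C"
    then obtain k where "\<forall>i\<ge>k. \<exists>\<delta>. \<delta> < \<beta> \<and>
        n_dim R (quotient_module (Q\<lparr>carrier := C (Suc i)\<rparr>) (C i)) \<delta>"
      using \<beta>(1) unfolding small_def by blast
    then show "\<exists>k. \<forall>i\<ge>k. \<exists>\<delta>. \<delta> < \<gamma> \<and> n_dim R (quotient_module (Q\<lparr>carrier := C (Suc i)\<rparr>) (C i)) \<delta>"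
      using less_le_trans[OF _ \<beta>(2)] by blast
  qed
  have rec: "n_dim R Q \<beta> \<longleftrightarrow> (\<forall>\<gamma>. \<gamma> < \<beta> \<longrightarrow> \<not> n_dim R Q \<gamma>) \<and> small \<beta>" if "\<exists>\<gamma>. \<gamma> < \<beta>" for \<beta>
    unfolding small_def by (rule n_dim_rec[OF Q that])
  have P: "P \<beta>" if "n_dim R Q \<beta>" for \<beta>
  proof (cases "\<exists>\<gamma>. \<gamma> < \<beta>")
    case True
    then show ?thesis using that rec[OF True] unfolding P_def by blast
  next
    case False
    then show ?thesis using that n_dim_bottom[of \<beta> R Q] unfolding P_def by simp
  qed
  have "n_dim_le R Q \<alpha> \<longleftrightarrow> P \<alpha>"
  proof
    assume "n_dim_le R Q \<alpha>"
    then obtain \<beta> where "\<beta> \<le> \<alpha>" "n_dim R Q \<beta>" unfolding n_dim_le_def by blast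
    then show "P \<alpha>" using P[of \<beta>] small_mono[of \<beta> \<alpha>] unfolding P_def by blast
  next
    assume "P \<alpha>"
    define \<beta> where "\<beta> = (LEAST \<beta>. P \<beta>)"
    have P_\<beta>: "P \<beta>" unfolding \<beta>_def using \<open>P \<alpha>\<close> by (rule LeastI)
    have least: "\<not> P \<gamma>" if "\<gamma> < \<beta>" for \<gamma>
      using that unfolding \<beta>_def by (rule not_less_Least)
    have "\<beta> \<le> \<alpha>" unfolding \<beta>_def using \<open>P \<alpha>\<close> by (rule Least_le)
    moreover have "n_dim R Q \<beta>"
    proof (cases "\<exists>\<gamma>. \<gamma> < \<beta>")
      case True
      then have "small \<beta>" using least P_\<beta> unfolding P_def by blast
      then show ?thesis using least P rec[OF True] by blast
    next
      case False
      have "ascending_chain R Q (\<lambda>_. carrier Q)"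
        by (simp add: ascending_chain_def Q.submodule_carrier)
      then have "\<not> small \<beta>" using False unfolding small_def by blast
      then show ?thesis using False P_\<beta> by (simp add: n_dim_bottom P_def)
    qed
    ultimately show "n_dim_le R Q \<alpha>" unfolding n_dim_le_def by blast
  qed
  then show ?thesis unfolding P_def small_def lt .
qed

lemma n_dim_le_isomorphic:
  assumes "right_module R M" "right_module R N" "right_module_isomorphic R M N"
  shows "n_dim_le R M \<alpha> \<longleftrightarrow> n_dim_le R N \<alpha>"
  using n_dim_isomorphic[OF assms] unfolding n_dim_le_def by blast

context right_module
begin

lemma submodule_restrict_iff:
  assumes "submodule B R M"
  shows "submodule C R (M\<lparr>carrier := B\<rparr>) \<longleftrightarrow> submodule C R M \<and> C \<subseteq> B"
proof -
  have "right_module R (M\<lparr>carrier := B\<rparr>)"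
    using right_module_submodule_is_module[OF _ assms] right_module_axioms by blast
  from right_module.submodule_iff[OF this, of C] show ?thesis
    using assms unfolding submodule_iff by auto
qed

lemma coset_eq_iff:
  assumes "submodule A R M" "x \<in> carrier M"
  shows "A +>\<^bsub>M\<^esub> x = A \<longleftrightarrow> x \<in> A"
proof -
  have A: "subgroup A (add_monoid M)" using assms(1) by (simp add: submodule_def)
  show ?thesis
    using group.rcos_self[OF M.a_group _ A] group.coset_join2[OF M.a_group _ A] assms(2)
    by (auto simp: a_r_coset_def)
qed

lemma right_module_epi_quotient:
  assumes A: "submodule A R M"
  shows "right_module_epi R M (quotient_module M A) (\<lambda>x. A +>\<^bsub>M\<^esub> x)"
proof -
  interpret A: submodule A R M by (rule A)
  interpret A': abelian_subgroup A M
    by (rule abelian_subgroupI3) (auto intro: additive_subgroup.intro A.subgroup_axioms M.abelian_group_axioms)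
  show ?thesis
  proof (intro right_module_epi.intro right_module_epi_axioms.intro)
    show "right_module R M" by (rule right_module_axioms)
    then show "right_module R (quotient_module M A)" by (rule quotient_module_right_module[OF _ A])
    show "(\<lambda>x. A +>\<^bsub>M\<^esub> x) ` carrier M = carrier (quotient_module M A)"
      by (auto simp: quotient_module_def A_RCOSETS_def')
    show "A +>\<^bsub>M\<^esub> (x \<oplus>\<^bsub>M\<^esub> y) = (A +>\<^bsub>M\<^esub> x) \<oplus>\<^bsub>quotient_module M A\<^esub> (A +>\<^bsub>M\<^esub> y)"
      if "x \<in> carrier M" "y \<in> carrier M" for x y
      using that A'.a_rcos_sum by (simp add: quotient_module_def)
    show "A +>\<^bsub>M\<^esub> (a \<odot>\<^bsub>M\<^esub> x) = a \<odot>\<^bsub>quotient_module M A\<^esub> (A +>\<^bsub>M\<^esub> x)"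
      if ax: "a \<in> carrier R" "x \<in> carrier M" for a x
    proof -
      have "A +>\<^bsub>M\<^esub> (a \<odot>\<^bsub>M\<^esub> y) = A +>\<^bsub>M\<^esub> (a \<odot>\<^bsub>M\<^esub> x)" if y: "y \<in> A +>\<^bsub>M\<^esub> x" for y
      proof -
        obtain h where h: "h \<in> A" "y = h \<oplus>\<^bsub>M\<^esub> x" using y by (auto simp: a_r_coset_def')
        have hM: "h \<in> carrier M" using h A'.a_subset by blast
        have "a \<odot>\<^bsub>M\<^esub> y = a \<odot>\<^bsub>M\<^esub> h \<oplus>\<^bsub>M\<^esub> a \<odot>\<^bsub>M\<^esub> x"
          using h hM ax by (simp add: smult_r_distr)
        then have "a \<odot>\<^bsub>M\<^esub> y \<in> A +>\<^bsub>M\<^esub> (a \<odot>\<^bsub>M\<^esub> x)"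
          using A.smult_closed[OF ax(1) h(1)] by (auto simp: a_r_coset_def')
        then show ?thesis
          using M.a_repr_independence[OF _ _ A'.a_subgroup] ax smult_closed by metis
      qed
      moreover have "x \<in> A +>\<^bsub>M\<^esub> x" using ax A'.a_rcos_self by blast
      ultimately have "(\<Union>y\<in>A +>\<^bsub>M\<^esub> x. A +>\<^bsub>M\<^esub> (a \<odot>\<^bsub>M\<^esub> y)) = A +>\<^bsub>M\<^esub> (a \<odot>\<^bsub>M\<^esub> x)"
        by blast
      then show ?thesis by (simp add: quotient_module_def)
    qed
  qed
qed

text \<open>
  By the correspondence theorem the chains of submodules of \<open>B/A\<close> are the images of the chains
  between \<open>A\<close> and \<open>B\<close>, and by the third isomorphism theorem corresponding factors are isomorphic;
  so both sides satisfy the same recursion.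
\<close>

theorem n_dim_le_factor_iff:
  fixes \<alpha> :: "'o :: wellorder"
  assumes "submodule A R M" "submodule B R M" "A \<subseteq> B"
  shows "n_dim_le R (quotient_module (M\<lparr>carrier := B\<rparr>) A) \<alpha> \<longleftrightarrow> codev_le {H. submodule H R M} A B \<alpha>"
  using assms
proof (induction \<alpha> arbitrary: A B rule: less_induct)
  case (less \<alpha>)
  note A = less.prems(1) and B = less.prems(2) and AB = less.prems(3)
  let ?S = "{H. submodule H R M}"
  define P where "P = M\<lparr>carrier := B\<rparr>"
  define Q where "Q = quotient_module P A"
  define f where "f x = A +>\<^bsub>P\<^esub> x" for x
  have P: "right_module R P"
    unfolding P_def by (rule right_module_submodule_is_module[OF right_module_axioms B])
  have sub_P: "submodule C R P \<longleftrightarrow> submodule C R M \<and> C \<subseteq> B" for C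
    unfolding P_def by (rule submodule_restrict_iff[OF B])
  have car_P: "carrier P = B" by (simp add: P_def)
  have A_P: "submodule A R P" using A AB by (simp add: sub_P)
  have zero_Q: "\<zero>\<^bsub>Q\<^esub> = A" by (simp add: Q_def quotient_module_def)
  interpret f: right_module_epi R P Q f
    unfolding Q_def f_def by (rule right_module.right_module_epi_quotient[OF P A_P])
  have ker: "f x = \<zero>\<^bsub>Q\<^esub> \<longleftrightarrow> x \<in> A" if "x \<in> B" for x
    using right_module.coset_eq_iff[OF P A_P] that by (simp add: f_def zero_Q car_P)
  have trivial: "carrier Q = {\<zero>\<^bsub>Q\<^esub>} \<longleftrightarrow> A = B"
  proof -
    have "carrier Q = {\<zero>\<^bsub>Q\<^esub>} \<longleftrightarrow> (\<forall>x\<in>B. f x = \<zero>\<^bsub>Q\<^esub>)"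
      using f.onto f.N.M.zero_closed car_P by auto
    then show ?thesis using ker AB by auto
  qed
  have factor: "n_dim_le R (quotient_module (Q\<lparr>carrier := f ` D\<rparr>) (f ` C)) \<beta> \<longleftrightarrow> codev_le ?S C D \<beta>"
    if CD: "submodule C R M" "submodule D R M" "A \<subseteq> C" "C \<subseteq> D" "D \<subseteq> B" and \<beta>: "\<beta> < \<alpha>" for C D \<beta>
  proof -
    have CD_P: "submodule C R P" "submodule D R P" using CD by (auto simp: sub_P)
    have PD: "P\<lparr>carrier := D\<rparr> = M\<lparr>carrier := D\<rparr>" by (simp add: P_def)
    have "right_module_isomorphic R (quotient_module (P\<lparr>carrier := D\<rparr>) C)
        (quotient_module (Q\<lparr>carrier := f ` D\<rparr>) (f ` C))"
      by (rule f.factor_isomorphic_image[OF CD_P CD(4)]) (use ker car_P CD(3) in auto)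
    moreover have "right_module R (quotient_module (P\<lparr>carrier := D\<rparr>) C)"
      by (rule quotient_module_right_module[OF right_module_submodule_is_module[OF P CD_P(2)]
            submodule_restrict[OF CD_P CD(4) P]])
    moreover have "right_module R (quotient_module (Q\<lparr>carrier := f ` D\<rparr>) (f ` C))"
      by (rule quotient_module_right_module[OF right_module_submodule_is_module submodule_restrict])
        (use CD(4) f.submodule_image CD_P f.N.right_module_axioms in blast)+
    ultimately have "n_dim_le R (quotient_module (Q\<lparr>carrier := f ` D\<rparr>) (f ` C)) \<beta> \<longleftrightarrow>
        n_dim_le R (quotient_module (M\<lparr>carrier := D\<rparr>) C) \<beta>"
      using n_dim_le_isomorphic unfolding PD by blast
    also have "\<dots> \<longleftrightarrow> codev_le ?S C D \<beta>" using less.IH[OF \<beta> CD(1,2,4)] .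
    finally show ?thesis .
  qed
  have small: "(\<exists>\<beta>. \<beta> < \<alpha> \<and> n_dim_le R (quotient_module (Q\<lparr>carrier := f ` C (Suc i)\<rparr>) (f ` C i)) \<beta>) \<longleftrightarrow>
      (\<exists>\<beta>. \<beta> < \<alpha> \<and> codev_le ?S (C i) (C (Suc i)) \<beta>)" if "chain_between ?S A B C" for C i
    using factor[of "C i" "C (Suc i)"] that unfolding chain_between_def by (metis mem_Collect_eq)
  have image: "ascending_chain R Q (\<lambda>i. f ` C i)" if "chain_between ?S A B C" for C
    using that f.submodule_image unfolding ascending_chain_def chain_between_def sub_P
    by (auto intro: image_mono)
  have preimage: "\<exists>C. chain_between ?S A B C \<and> C' = (\<lambda>i. f ` C i)" if C': "ascending_chain R Q C'" for C'
  proof -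
    define C where "C i = {x \<in> carrier P. f x \<in> C' i}" for i
    have sub: "submodule (C' i) R Q" "C' i \<subseteq> C' (Suc i)" for i
      using C' by (auto simp: ascending_chain_def)
    have "submodule (C i) R P" for i unfolding C_def by (rule f.submodule_preimage[OF sub(1)])
    moreover have "A \<subseteq> C i" for i
    proof
      fix x assume "x \<in> A"
      then have "x \<in> B" "f x = \<zero>\<^bsub>Q\<^esub>" using AB ker by auto
      then show "x \<in> C i" using sub(1)[of i] by (simp add: C_def car_P f.N.submodule_iff)
    qed
    moreover have "C i \<subseteq> C (Suc i)" for i using sub(2)[of i] by (auto simp: C_def)
    ultimately have "chain_between ?S A B C" by (simp add: chain_between_def sub_P)
    moreover have "f ` C i = C' i" for i
    proof -
      have "C' i \<subseteq> f ` carrier P" using f.onto sub(1)[of i] by (simp add: f.N.submodule_iff)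
      then show ?thesis unfolding C_def by blast
    qed
    ultimately show ?thesis by (intro exI[of _ C]) auto
  qed
  show ?case
    unfolding codev_le_iff[of _ A B] P_def[symmetric] Q_def[symmetric]
      n_dim_le_iff[OF f.N.right_module_axioms] trivial
  proof (intro disj_cong refl iffI allI impI)
    fix C assume C: "chain_between ?S A B C"
      and "\<forall>C'. ascending_chain R Q C' \<longrightarrow> (\<exists>k. \<forall>i\<ge>k. \<exists>\<beta>. \<beta> < \<alpha> \<and>
        n_dim_le R (quotient_module (Q\<lparr>carrier := C' (Suc i)\<rparr>) (C' i)) \<beta>)"
    from this(2)[rule_format, OF image[OF C]]
    show "\<exists>k. \<forall>i\<ge>k. \<exists>\<beta>. \<beta> < \<alpha> \<and> codev_le ?S (C i) (C (Suc i)) \<beta>"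
      unfolding small[OF C] .
  next
    fix C' assume C': "ascending_chain R Q C'"
      and *: "\<forall>C. chain_between ?S A B C \<longrightarrow>
        (\<exists>k. \<forall>i\<ge>k. \<exists>\<beta>. \<beta> < \<alpha> \<and> codev_le ?S (C i) (C (Suc i)) \<beta>)"
    obtain C where C: "chain_between ?S A B C" "C' = (\<lambda>i. f ` C i)" using preimage[OF C'] by blast
    show "\<exists>k. \<forall>i\<ge>k. \<exists>\<beta>. \<beta> < \<alpha> \<and>
        n_dim_le R (quotient_module (Q\<lparr>carrier := C' (Suc i)\<rparr>) (C' i)) \<beta>"
      using *[rule_format, OF C(1)] unfolding C(2) small[OF C(1)] .
  qed
qed

lemma isomorphic_quotient_zero:
  "right_module_isomorphic R M (quotient_module M {\<zero>\<^bsub>M\<^esub>})"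
proof -
  let ?f = "\<lambda>x. {\<zero>\<^bsub>M\<^esub>} +>\<^bsub>M\<^esub> x"
  interpret f: right_module_epi R M "quotient_module M {\<zero>\<^bsub>M\<^esub>}" ?f
    by (rule right_module_epi_quotient[OF submodule_zero])
  have "inj_on ?f (carrier M)" by (rule inj_onI) (simp add: a_r_coset_def')
  then have "?f \<in> right_module_iso R M (quotient_module M {\<zero>\<^bsub>M\<^esub>})"
    by (simp add: right_module_iso_def bij_betw_def f.onto f.map_add f.map_smult)
  then show ?thesis unfolding right_module_isomorphic_def by blast
qed

lemma n_dim_le_iff_codev_le:
  "n_dim_le R M \<alpha> \<longleftrightarrow> codev_le {H. submodule H R M} {\<zero>\<^bsub>M\<^esub>} (carrier M) \<alpha>"
proof -
  have "n_dim_le R M \<alpha> \<longleftrightarrow> n_dim_le R (quotient_module M {\<zero>\<^bsub>M\<^esub>}) \<alpha>"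
    by (rule n_dim_le_isomorphic[OF right_module_axioms
          quotient_module_right_module[OF right_module_axioms submodule_zero] isomorphic_quotient_zero])
  then show ?thesis
    using n_dim_le_factor_iff[OF submodule_zero submodule_carrier, of \<alpha>] by simp
qed

section \<open>Inverse systems in AB5* modules\<close>

text \<open>
  An element of \<open>Y \<inter> (X + A)\<close> outside \<open>X\<close> may be moved into \<open>A\<close> by subtracting an element of
  \<open>X\<close>.  AB5* gives \<open>X = \<Inter>{X + A' |A'. A' \<in> \<A>}\<close>, so some \<open>X + A'\<close> excludes it, and
  directedness allows \<open>A' \<subseteq> A\<close>.
\<close>

lemma AB5_star_separation:
  assumes AB5: "AB5_star R M"
    and \<A>: "\<And>A. A \<in> \<A> \<Longrightarrow> submodule A R M"
    and dir: "\<And>A\<^sub>1 A\<^sub>2. \<lbrakk>A\<^sub>1 \<in> \<A>; A\<^sub>2 \<in> \<A>\<rbrakk> \<Longrightarrow> \<exists>A\<in>\<A>. A \<subseteq> A\<^sub>1 \<and> A \<subseteq> A\<^sub>2"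
    and X: "submodule X R M" and Y: "submodule Y R M" and "X \<subseteq> Y" "\<Inter>\<A> \<subseteq> X"
    and A: "A \<in> \<A>" and "\<not> Y \<inter> (X <+>\<^bsub>M\<^esub> A) \<subseteq> X"
  shows "\<exists>A'\<in>\<A>. A' \<subseteq> A \<and> (\<exists>d\<in>Y \<inter> A. d \<notin> X <+>\<^bsub>M\<^esub> A')"
proof -
  obtain x where x: "x \<in> Y" "x \<in> X <+>\<^bsub>M\<^esub> A" "x \<notin> X" using assms(9) by blast
  then obtain c d where cd: "c \<in> X" "d \<in> A" "d \<in> Y" "x = c \<oplus>\<^bsub>M\<^esub> d"
    using mem_set_addE[of x X A Y] X Y \<A>[OF A] \<open>X \<subseteq> Y\<close> by blast
  have "X <+>\<^bsub>M\<^esub> (\<Inter>A\<in>\<A>. A) = (\<Inter>A\<in>\<A>. X <+>\<^bsub>M\<^esub> A)"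
    by (rule AB5[unfolded AB5_star_def, rule_format]) (use X \<A> dir A in blast)
  moreover have "X <+>\<^bsub>M\<^esub> (\<Inter>A\<in>\<A>. A) \<subseteq> X"
  proof
    fix z assume "z \<in> X <+>\<^bsub>M\<^esub> (\<Inter>A\<in>\<A>. A)"
    then obtain u v where "u \<in> X" "v \<in> \<Inter>\<A>" "z = u \<oplus>\<^bsub>M\<^esub> v" unfolding mem_set_add by auto
    then show "z \<in> X" using X \<open>\<Inter>\<A> \<subseteq> X\<close> by (simp add: submodule_iff subset_iff)
  qed
  ultimately obtain A\<^sub>0 where A\<^sub>0: "A\<^sub>0 \<in> \<A>" "x \<notin> X <+>\<^bsub>M\<^esub> A\<^sub>0" using x(3) by blast
  obtain A' where A': "A' \<in> \<A>" "A' \<subseteq> A" "A' \<subseteq> A\<^sub>0" using dir[OF A A\<^sub>0(1)] by blast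
  have x_A': "x \<notin> X <+>\<^bsub>M\<^esub> A'" using A\<^sub>0(2) A'(3) set_add_mono[of X X A' A\<^sub>0] by blast
  have "d \<notin> X <+>\<^bsub>M\<^esub> A'"
  proof
    assume d: "d \<in> X <+>\<^bsub>M\<^esub> A'"
    have S: "submodule (X <+>\<^bsub>M\<^esub> A') R M" by (rule submodule_set_add[OF X \<A>[OF A'(1)]])
    have "c \<in> X <+>\<^bsub>M\<^esub> A'" using set_add_upper(1)[OF X \<A>[OF A'(1)]] cd(1) by blast
    then have "x \<in> X <+>\<^bsub>M\<^esub> A'" using S d cd(4) by (simp add: submodule_iff)
    with x_A' show False ..
  qed
  then show ?thesis using A' cd by blast
qed

text \<open>
  The bound \<open>\<delta>\<close> on the dimension of \<open>M\<close> enters only through the absence of independent sequences;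
  this is why it may be a value in another well-ordered type.
\<close>

theorem codev_le_Inter_directed:
  fixes \<alpha> :: "'o :: wellorder" and \<delta> :: "'p :: wellorder"
  assumes AB5: "AB5_star R M"
    and dim: "codev_le {H. submodule H R M} {\<zero>\<^bsub>M\<^esub>} (carrier M) \<delta>"
    and "\<A> \<noteq> {}" and \<A>: "\<And>A. A \<in> \<A> \<Longrightarrow> submodule A R M"
    and dir: "\<And>A\<^sub>1 A\<^sub>2. \<lbrakk>A\<^sub>1 \<in> \<A>; A\<^sub>2 \<in> \<A>\<rbrakk> \<Longrightarrow> \<exists>A\<in>\<A>. A \<subseteq> A\<^sub>1 \<and> A \<subseteq> A\<^sub>2"
    and le: "\<And>A. A \<in> \<A> \<Longrightarrow> codev_le {H. submodule H R M} A (carrier M) \<alpha>"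
  shows "codev_le {H. submodule H R M} (\<Inter>\<A>) (carrier M) \<alpha>"
proof (cases "\<exists>\<gamma>. \<gamma> < \<alpha>")
  case False
  have "A = carrier M" if "A \<in> \<A>" for A
    by (rule codev_le_bottomD[OF le[OF that]])
      (use False \<A>[OF that] in \<open>auto simp: submodule_iff\<close>)
  then have "\<Inter>\<A> = carrier M" using \<open>\<A> \<noteq> {}\<close> by blast
  then show ?thesis by (simp add: codev_le_refl)
next
  case True
  then obtain \<gamma> where \<gamma>: "\<gamma> < \<alpha>" ..
  let ?S = "{H. submodule H R M}"
  show ?thesis
  proof (rule codev_le_chain, rule ccontr)
    fix C assume "chain_between ?S (\<Inter>\<A>) (carrier M) C"
    then have C: "submodule (C i) R M" "\<Inter>\<A> \<subseteq> C i" "C i \<subseteq> C (Suc i)" for i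
      by (auto simp: chain_between_def)
    assume "\<not> (\<exists>k. \<forall>i\<ge>k. \<exists>\<beta>. \<beta> < \<alpha> \<and> codev_le ?S (C i) (C (Suc i)) \<beta>)"
    then have large: "\<exists>i\<ge>k. \<not> (\<exists>\<beta>. \<beta> < \<alpha> \<and> codev_le ?S (C i) (C (Suc i)) \<beta>)" for k
      by blast
    have step: "\<exists>i\<ge>k. \<exists>A'\<in>\<A>. A' \<subseteq> A \<and> (\<exists>d\<in>C (Suc i) \<inter> A. d \<notin> C i <+>\<^bsub>M\<^esub> A')"
      if A: "A \<in> \<A>" for A k
    proof -
      have "chain_between ?S A (carrier M) (\<lambda>i. C i <+>\<^bsub>M\<^esub> A)"
        using submodule_set_add[OF C(1) \<A>[OF A]] set_add_upper(2)[OF C(1) \<A>[OF A]] set_add_mono[OF C(3)]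
        by (auto simp: chain_between_def submodule_iff)
      from codev_le_chainD[OF le[OF A] \<gamma> this] obtain l where
        l: "\<And>i. i \<ge> l \<Longrightarrow> \<exists>\<beta>. \<beta> < \<alpha> \<and> codev_le ?S (C i <+>\<^bsub>M\<^esub> A) (C (Suc i) <+>\<^bsub>M\<^esub> A) \<beta>"
        by blast
      obtain i where i: "i \<ge> max k l" "\<not> (\<exists>\<beta>. \<beta> < \<alpha> \<and> codev_le ?S (C i) (C (Suc i)) \<beta>)"
        using large by blast
      \<comment> \<open>Otherwise the factor would be isomorphic to one of \<open>C i + A\<close>, which is too small.\<close>
      have "\<not> C (Suc i) \<inter> (C i <+>\<^bsub>M\<^esub> A) \<subseteq> C i"
        using codev_le_second_iso[OF _ C(1) C(1) \<A>[OF A] C(3), of i] i l[of i] by auto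
      from AB5_star_separation[OF AB5 \<A> dir C(1) C(1) C(3) C(2) A this]
      show ?thesis using i(1) by auto
    qed
    \<comment> \<open>Each new \<open>d'\<close> lies in the previous \<open>A\<close>, hence in all earlier \<open>G\<close>; as indices increase, it
      also lies in all later \<open>C i\<close>.\<close>
    define Q where "Q = (\<lambda>(n :: nat) (i, A, d :: 'b) (i', A', d'). i < i' \<and> A' \<in> \<A> \<and> A' \<subseteq> A \<and>
      d' \<in> C (Suc i') \<inter> A \<and> d' \<notin> C i' <+>\<^bsub>M\<^esub> A')"
    have "\<exists>s. \<forall>n. fst (snd (s n)) \<in> \<A> \<and> Q n (s n) (s (Suc n))"
    proof (rule dependent_nat_choice)
      show "\<exists>x :: nat \<times> 'b set \<times> 'b. fst (snd x) \<in> \<A>" using \<open>\<A> \<noteq> {}\<close> by auto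
      fix x :: "nat \<times> 'b set \<times> 'b" and n assume x: "fst (snd x) \<in> \<A>"
      obtain i A d where [simp]: "x = (i, A, d)" by (cases x) auto
      from step[of A "Suc i"] x obtain i' A' d' where "i' \<ge> Suc i" "A' \<in> \<A>" "A' \<subseteq> A"
        "d' \<in> C (Suc i') \<inter> A" "d' \<notin> C i' <+>\<^bsub>M\<^esub> A'" by auto
      then show "\<exists>y. fst (snd y) \<in> \<A> \<and> Q n x y"
        by (intro exI[of _ "(i', A', d')"]) (simp add: Q_def)
    qed
    then obtain s where s: "\<And>n. fst (snd (s n)) \<in> \<A>" "\<And>n. Q n (s n) (s (Suc n))" by blast
    define \<kappa> A d where "\<kappa> n = fst (s n)" and "A n = fst (snd (s n))" and "d n = snd (snd (s n))" for n
    have s': "s n = (\<kappa> n, A n, d n)" for n by (simp add: \<kappa>_def A_def d_def)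
    have seq: "\<kappa> n < \<kappa> (Suc n)" "A n \<in> \<A>" "A (Suc n) \<subseteq> A n" "d (Suc n) \<in> C (Suc (\<kappa> (Suc n)))"
      "d (Suc n) \<in> A n" "d (Suc n) \<notin> C (\<kappa> (Suc n)) <+>\<^bsub>M\<^esub> A (Suc n)" for n
      using s(1)[of n] s(2)[of n] unfolding s' Q_def by auto
    have \<kappa>_mono: "\<kappa> m < \<kappa> n" if "m < n" for m n using lift_Suc_mono_less[of \<kappa>, OF seq(1) that] .
    have A_mono: "A n \<subseteq> A m" if "m \<le> n" for m n using lift_Suc_antimono_le[of A, OF seq(3) that] .
    have C_mono: "C m \<subseteq> C n" if "m \<le> n" for m n using lift_Suc_mono_le[of C, OF C(3) that] .
    \<comment> \<open>The shift drops the initial triple, whose third component is arbitrary.\<close>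
    define G where "G n = C (\<kappa> (Suc n)) <+>\<^bsub>M\<^esub> A (Suc n)" for n
    have G: "submodule (G n) R M" "C (\<kappa> (Suc n)) \<subseteq> G n" "A (Suc n) \<subseteq> G n" for n
      using submodule_set_add[OF C(1) \<A>[OF seq(2)]] set_add_upper[OF C(1) \<A>[OF seq(2)]]
      unfolding G_def by blast+
    have "d (Suc j) \<in> G i \<longleftrightarrow> i \<noteq> j" for i j
    proof (cases i j rule: linorder_cases)
      case less
      then have "d (Suc j) \<in> A (Suc i)" using seq(5)[of j] A_mono[of "Suc i" j] by auto
      then show ?thesis using G(3) less by auto
    next
      case equal
      then show ?thesis using seq(6)[of j] by (simp add: G_def)
    next
      case greater
      then have "Suc (\<kappa> (Suc j)) \<le> \<kappa> (Suc i)" using \<kappa>_mono[of "Suc j" "Suc i"] by simp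
      then have "d (Suc j) \<in> C (\<kappa> (Suc i))" using seq(4)[of j] C_mono by blast
      then show ?thesis using G(2) greater by auto
    qed
    moreover have "d (Suc j) \<in> carrier M" for j
      using seq(4)[of j] C(1)[of "Suc (\<kappa> (Suc j))"] by (auto simp: submodule_iff)
    ultimately have "independent_sequence ?S {\<zero>\<^bsub>M\<^esub>} (carrier M) G (\<lambda>j. d (Suc j))"
      using G(1) submodule_carrier unfolding independent_sequence_def by (simp add: submodule_iff)
    moreover have "\<Inter>\<H> \<in> ?S" if "\<H> \<subseteq> ?S" "\<H> \<noteq> {}" for \<H>
      using submodule_Inter[of \<H>] that by blast
    ultimately show False using codev_le_no_independent_sequence[OF dim] by blast
  qed
qed

end

theorem theorem2p11:
  fixes R :: "('a, 'm) ring_scheme" and M :: "('a, 'b) module"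
    and \<alpha> :: "'o :: wellorder" and N :: "'i \<Rightarrow> 'b set" and \<Delta> :: "'i set"
  assumes "right_module R M"
    and "AB5_star R M"
    and "\<exists>\<delta> :: 'p :: wellorder. n_dim R M \<delta>"
    and "\<And>i. i \<in> \<Delta> \<Longrightarrow> submodule (N i) R M"
    and "\<And>i. i \<in> \<Delta> \<Longrightarrow> n_dim_le R (quotient_module M (N i)) \<alpha>"
  shows "n_dim_le R (quotient_module M (carrier M \<inter> (\<Inter>i\<in>\<Delta>. N i))) \<alpha>"
proof -
  interpret right_module R M by (rule assms(1))
  let ?S = "{H. submodule H R M}"
  have quot: "n_dim_le R (quotient_module M A) \<alpha> \<longleftrightarrow> codev_le ?S A (carrier M) \<alpha>"
    if "submodule A R M" for A
    using n_dim_le_factor_iff[OF that submodule_carrier, of \<alpha>] that by (simp add: submodule_iff)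
  obtain \<delta> :: 'p where "n_dim_le R M \<delta>" using assms(3) unfolding n_dim_le_def by blast
  then have dim: "codev_le ?S {\<zero>\<^bsub>M\<^esub>} (carrier M) \<delta>" by (simp add: n_dim_le_iff_codev_le)
  define K where "K F = carrier M \<inter> (\<Inter>i\<in>F. N i)" for F
  have K: "submodule (K F) R M" if "F \<subseteq> \<Delta>" for F
    using submodule_Inter[of "insert (carrier M) (N ` F)"] submodule_carrier assms(4) that
    unfolding K_def by auto
  have fin: "codev_le ?S (K F) (carrier M) \<alpha>" if "finite F" "F \<subseteq> \<Delta>" for F
    using that
  proof (induction F)
    case empty
    then show ?case by (simp add: K_def codev_le_refl)
  next
    case (insert i F)
    then have "codev_le ?S (N i) (carrier M) \<alpha>" using assms(4,5) quot by simp
    then have "codev_le ?S (N i \<inter> K F) (carrier M) \<alpha>"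
      using codev_le_Int[of "N i" "K F"] insert K assms(4) by simp
    moreover have "N i \<inter> K F = K (insert i F)" by (auto simp: K_def)
    ultimately show ?case by simp
  qed
  have "codev_le ?S (\<Inter>{K F |F. finite F \<and> F \<subseteq> \<Delta>}) (carrier M) \<alpha>"
  proof (rule codev_le_Inter_directed[OF assms(2) dim])
    fix A\<^sub>1 A\<^sub>2 assume "A\<^sub>1 \<in> {K F |F. finite F \<and> F \<subseteq> \<Delta>}" "A\<^sub>2 \<in> {K F |F. finite F \<and> F \<subseteq> \<Delta>}"
    then obtain F\<^sub>1 F\<^sub>2 where F: "A\<^sub>1 = K F\<^sub>1" "A\<^sub>2 = K F\<^sub>2" "finite (F\<^sub>1 \<union> F\<^sub>2)" "F\<^sub>1 \<union> F\<^sub>2 \<subseteq> \<Delta>" by auto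
    moreover have "K (F\<^sub>1 \<union> F\<^sub>2) \<subseteq> K F\<^sub>1" "K (F\<^sub>1 \<union> F\<^sub>2) \<subseteq> K F\<^sub>2" by (auto simp: K_def)
    ultimately show "\<exists>A\<in>{K F |F. finite F \<and> F \<subseteq> \<Delta>}. A \<subseteq> A\<^sub>1 \<and> A \<subseteq> A\<^sub>2" by blast
  qed (use K fin in auto)
  moreover have "\<Inter>{K F |F. finite F \<and> F \<subseteq> \<Delta>} = K \<Delta>"
  proof
    have "x \<in> K \<Delta>" if x: "\<And>F. finite F \<Longrightarrow> F \<subseteq> \<Delta> \<Longrightarrow> x \<in> K F" for x
      using x[of "{}"] x[of "{_}"] by (auto simp: K_def)
    then show "\<Inter>{K F |F. finite F \<and> F \<subseteq> \<Delta>} \<subseteq> K \<Delta>" by blast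
    show "K \<Delta> \<subseteq> \<Inter>{K F |F. finite F \<and> F \<subseteq> \<Delta>}" by (auto simp: K_def)
  qed
  ultimately show ?thesis using quot[OF K[of \<Delta>]] by (simp add: K_def)
qed

end
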